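(* Consider the B-ary Tree Push-Pull (BTPP) iteration on $n$ agents with branch size $B$, tree diameter $d$, common initial point $x_i^{(0)}=x^{(0)}\in\mathbb R^p$ for all $i$, and assume: (i) for all $i$ and $x$, $\mathbb E[g_i(x,\xi_i)\mid x]=\nabla f_i(x)$ and $\mathbb E[\|g_i(x,\xi_i)-\nabla f_i(x)\|^2\mid x]\le\sigma^2$, the samples being independent; (ii) each $f_i$ is lower bounded with $L$-Lipschitz continuous gradient; (iii) $f$ is $\mu$-strongly convex, i.e. $f(y)\ge f(x)+\langle\nabla f(x),y-x\rangle+\frac\mu2\|y-x\|^2$ for all $x,y\in\mathbb R^p$. Let $x^*=\arg\min f$, $\kappa=L/\mu$, let $T\ge2d$ be an integer and $$\gamma=\min\left\{\frac1{100\,nd^2\kappa L},\ \frac{16\log(n(T+1)^2)}{n(T+1)\mu}\right\}.$$ Then $$\mathbb E\|x_1^{(T)}-x^*\|^2\le\frac{2240\,\sigma^2\log(n(T+1)^2)}{n(T+1)\mu^2}+\frac{26880000\,d^6\kappa^2\sigma^2\left(\log(n(T+1)^2)\right)^2}{n(T+1)^2\mu^2}$$ $$\qquad+\max\left\{\exp\left(-\frac{T}{800d^2\kappa^2}\right),\ \frac{40}{n(T+1)^2}\right\}\left(\|x_1^{(0)}-x^*\|^2+\frac1{nL^2}\|\nabla\mathbf F(\mathbf X^{(0)})\|_F^2\right).$$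
   Context: Trees: $B\ge2$, $n\ge2$ are integers and $d$ is the unique integer with $\frac{B^d-1}{B-1}<n\le\frac{B^{d+1}-1}{B-1}$ (the diameter/depth of the B-ary tree on $n$ nodes, indexed layer by layer from root $1$; $d\ge1$). $\mathcal R\in\mathbb R^{n\times n}$ has $\mathcal R_{ij}=1$ if $B(j-1)+2\le i\le Bj+1$ (with $i\le n$) or $i=j=1$, and $\mathcal R_{ij}=0$ otherwise; $\mathcal C=\mathcal R^\top$. Problem: $f_i:\mathbb R^p\to\mathbb R$ ($i=1,\dots,n$) are differentiable, $f=\frac1n\sum_{i=1}^nf_i$. Agent $i$ has a stochastic gradient $g_i(x,\xi_i)$ with $\xi_i\sim\mathcal D_i$; the samples $\xi_i^{(t)}\sim\mathcal D_i$ are independent over all agents $i$ and all times $t$. Constants $\sigma^2,L,\mu>0$. BTPP algorithm: with $\mathbf X^{(t)}=[x_1^{(t)},\dots,x_n^{(t)}]^\top$, $\mathbf Y^{(t)}=[y_1^{(t)},\dots,y_n^{(t)}]^\top\in\mathbb R^{n\times p}$, $\mathbf G^{(t)}=[g_1(x_1^{(t)},\xi_1^{(t)}),\dots,g_n(x_n^{(t)},\xi_n^{(t)})]^\top$, start from deterministic $\mathbf X^{(0)}$ with all rows equal to $x^{(0)\top}$, $\mathbf Y^{(0)}=\mathbf G^{(0)}$, and for $t\ge0$ $$\mathbf X^{(t+1)}=\mathcal R(\mathbf X^{(t)}-\gamma\mathbf Y^{(t)}),\qquad \mathbf Y^{(t+1)}=\mathcal C\mathbf Y^{(t)}+\mathbf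 G^{(t+1)}-\mathbf G^{(t)}.$$ $\nabla\mathbf F(\mathbf X)=[\nabla f_1(x_1),\dots,\nabla f_n(x_n)]^\top\in\mathbb R^{n\times p}$; $\|\cdot\|_F$ is the Frobenius norm, $\log$ the natural logarithm. *)

theory Defs
  imports "HOL-Probability.Probability"
begin

(* Agents are the natural numbers 1..n.  An n x n matrix is a function nat => nat => real and an
   n x p matrix is the function nat => real ^ 'p giving its rows; only indices in {1..n} matter. *)

definition gradient :: "('a::real_inner \<Rightarrow> real) \<Rightarrow> 'a \<Rightarrow> 'a" where
  "gradient f x = (THE D. GDERIV f x :> D)"

(* Phrased through the gradient, hence meant for differentiable f. *)
definition strongly_convex :: "real \<Rightarrow> ('a::real_inner \<Rightarrow> real) \<Rightarrow> bool" where
  "strongly_convex \<mu> f \<longleftrightarrow>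
     (\<forall>x y. f y \<ge> f x + gradient f x \<bullet> (y - x) + \<mu> / 2 * (norm (y - x))\<^sup>2)"

definition average_objective :: "nat \<Rightarrow> (nat \<Rightarrow> 'a \<Rightarrow> real) \<Rightarrow> 'a \<Rightarrow> real" where
  "average_objective n f x = 1 / real n * (\<Sum>i\<in>{1..n}. f i x)"

definition stacked_gradient ::
    "(nat \<Rightarrow> 'a::real_inner \<Rightarrow> real) \<Rightarrow> (nat \<Rightarrow> 'a) \<Rightarrow> nat \<Rightarrow> 'a" where
  "stacked_gradient f X i = gradient (f i) (X i)"

definition frobenius_norm :: "nat \<Rightarrow> (nat \<Rightarrow> real ^ 'p) \<Rightarrow> real" where
  "frobenius_norm n A = sqrt (\<Sum>i\<in>{1..n}. \<Sum>k\<in>UNIV. (A i $ k)\<^sup>2)"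

(* Row i, column j: j is the parent of i in the B-ary tree, with a self-loop at the root 1. *)
definition pull_matrix :: "nat \<Rightarrow> nat \<Rightarrow> nat \<Rightarrow> real" where
  "pull_matrix B i j =
     (if (B * (j - 1) + 2 \<le> i \<and> i \<le> B * j + 1) \<or> (i = 1 \<and> j = 1) then 1 else 0)"

definition push_matrix :: "nat \<Rightarrow> nat \<Rightarrow> nat \<Rightarrow> real" where
  "push_matrix B i j = pull_matrix B j i"

(* The iteration along one realisation s of the samples: s i t is the sample of agent i at time t.
   btpp_X ... t i and btpp_Y ... t i are the i-th rows of X^(t) and Y^(t). *)
function btpp_X :: "nat \<Rightarrow> nat \<Rightarrow> real \<Rightarrow> (nat \<Rightarrow> 'a::real_vector \<Rightarrow> 's \<Rightarrow> 'a) \<Rightarrow> 'a \<Rightarrow>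
      (nat \<Rightarrow> nat \<Rightarrow> 's) \<Rightarrow> nat \<Rightarrow> nat \<Rightarrow> 'a"
  and btpp_Y :: "nat \<Rightarrow> nat \<Rightarrow> real \<Rightarrow> (nat \<Rightarrow> 'a::real_vector \<Rightarrow> 's \<Rightarrow> 'a) \<Rightarrow> 'a \<Rightarrow>
      (nat \<Rightarrow> nat \<Rightarrow> 's) \<Rightarrow> nat \<Rightarrow> nat \<Rightarrow> 'a"
where
  "btpp_X B n \<gamma> g x0 s 0 i = x0"
| "btpp_X B n \<gamma> g x0 s (Suc t) i =
     (\<Sum>j\<in>{1..n}. pull_matrix B i j *\<^sub>R
        (btpp_X B n \<gamma> g x0 s t j - \<gamma> *\<^sub>R btpp_Y B n \<gamma> g x0 s t j))"
| "btpp_Y B n \<gamma> g x0 s 0 i = g i (btpp_X B n \<gamma> g x0 s 0 i) (s i 0)"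
| "btpp_Y B n \<gamma> g x0 s (Suc t) i =
     (\<Sum>j\<in>{1..n}. push_matrix B i j *\<^sub>R btpp_Y B n \<gamma> g x0 s t j)
     + g i (btpp_X B n \<gamma> g x0 s (Suc t) i) (s i (Suc t))
     - g i (btpp_X B n \<gamma> g x0 s t i) (s i t)"
  by pat_completeness auto
termination
  by (relation "Wellfounded.measure (\<lambda>z. case z of
        Inl (B, n, \<gamma>, g, x0, s, t, i) \<Rightarrow> 2 * t
      | Inr (B, n, \<gamma>, g, x0, s, t, i) \<Rightarrow> 2 * t + 1)") auto

end

theory Submission
  imports Defs
begin

text \<open>A sample \<open>\<xi> l u\<close> of agent \<open>l\<close> first reaches the root at the virtual time \<open>u + depth l\<close>. Unrolling
  the push step, the tracker of the root at time \<open>\<tau>\<close> is the sum over all agents \<open>l\<close> of the stochastic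
  gradients taken at time \<open>\<tau> - depth l\<close>, and the tracker of any other node is a sum of increments of such
  gradients over its subtree. All iterates entering the root at virtual time \<open>\<tau>\<close> depend only on samples of
  smaller virtual time, so the root performs SGD with step \<open>\<eta> = n \<gamma>\<close>, with unbiased and pairwise
  uncorrelated noises, but with gradients taken at perturbed points. By strong induction on \<open>\<tau>\<close> one shows
  that the mean squared error of the root is at most \<open>r\<^bsup>2\<tau>\<^esup> W + N\<close>, where \<open>r = 1 - \<eta> \<mu> / 16\<close> and
  \<open>N = 100 \<eta> \<sigma>\<^sup>2 / (n \<mu>)\<close> is the noise floor, and that the
  perturbations are at most a small multiple of \<open>\<mu> / L\<close> times the corresponding root mean square error
  \<open>K = r\<^bsup>\<tau>\<^esup> \<surd>V + \<surd>N\<close>, because every edge of the tree only contributes a few steps of the root.\<close>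

section \<open>Mean square bounds and independence\<close>

text \<open>The errors of different nodes and times may be correlated, so perturbations are added in
  root mean square by Minkowski, without hoping for cancellation. Orthogonality is used only for the
  noises of one virtual time, against each other and against the past. Along a path of at most
  \<open>d\<close> edges the perturbation must stay below \<open>16 / 100 * (\<mu> / L) * K\<close>:
  the squared root error then pays about a tenth of \<open>\<eta> * \<mu> * K\<^sup>2\<close> per
  step, which the contraction \<open>1 - 13 / 10 * (\<eta> * \<mu>)\<close> of a gradient step can
  afford. The rate in \<open>r\<close> is deliberately slow. On the one hand \<open>K\<close> is
  almost constant over \<open>2 * d\<close> steps, so delays cost hardly anything; on the other hand
  \<open>r\<^sup>2\<close> is close to \<open>1 - \<eta> * \<mu> / 8\<close>, and with the largest
  admissible \<open>\<eta> = \<mu> / (100 * d\<^sup>2 * L\<^sup>2)\<close> this gives the exponent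
  \<open>T / (800 * d\<^sup>2 * \<kappa>\<^sup>2)\<close>. The factor 100 in \<open>N\<close> makes
  the noise variance of one root step equal to \<open>\<eta> * \<mu> * N / 100\<close>, a small part
  of what the contraction removes from \<open>N\<close>.\<close>

definition l2_le :: "'w measure \<Rightarrow> ('w \<Rightarrow> 'a::euclidean_space) \<Rightarrow> real \<Rightarrow> bool" where
  "l2_le M X c \<longleftrightarrow> X \<in> borel_measurable M \<and> integrable M (\<lambda>\<omega>. (norm (X \<omega>))\<^sup>2) \<and>
     0 \<le> c \<and> (\<integral>\<omega>. (norm (X \<omega>))\<^sup>2 \<partial>M) \<le> c\<^sup>2"

lemma l2_leD:
  assumes "l2_le M X c"
  shows "X \<in> borel_measurable M" "integrable M (\<lambda>\<omega>. (norm (X \<omega>))\<^sup>2)" "0 \<le> c"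
    "(\<integral>\<omega>. (norm (X \<omega>))\<^sup>2 \<partial>M) \<le> c\<^sup>2"
  using assms by (auto simp: l2_le_def)

lemma l2_le_mono: "l2_le M X c \<Longrightarrow> c \<le> c' \<Longrightarrow> l2_le M X c'"
  unfolding l2_le_def by (meson order_trans power_mono)

text \<open>The weight \<open>t\<close> stays free: the optimal ratio yields Minkowski's inequality,
  while a small multiple of \<open>\<eta> * \<mu>\<close> lets a contraction absorb error
  terms.\<close>

lemma norm_add_sq_le_Young:
  fixes x y :: "'a::real_inner"
  assumes "t > 0"
  shows "(norm (x + y))\<^sup>2 \<le> (1 + t) * (norm x)\<^sup>2 + (1 + 1 / t) * (norm y)\<^sup>2"
proof -
  have "0 \<le> (norm (t *\<^sub>R x - y))\<^sup>2 / t" using assms by simp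
  also have "\<dots> = t * (norm x)\<^sup>2 - 2 * (x \<bullet> y) + (norm y)\<^sup>2 / t"
    using assms unfolding power2_norm_eq_inner
    by (simp add: inner_diff_left inner_diff_right inner_commute field_simps)
  finally show ?thesis
    unfolding power2_norm_eq_inner
    by (simp add: inner_add_left inner_add_right inner_commute algebra_simps)
qed

lemma integrable_norm_add_sq:
  fixes X Y :: "'w \<Rightarrow> 'a::euclidean_space"
  assumes [measurable]: "X \<in> borel_measurable M" "Y \<in> borel_measurable M"
    and "integrable M (\<lambda>\<omega>. (norm (X \<omega>))\<^sup>2)" "integrable M (\<lambda>\<omega>. (norm (Y \<omega>))\<^sup>2)"
  shows "integrable M (\<lambda>\<omega>. (norm (X \<omega> + Y \<omega>))\<^sup>2)"
proof (rule Bochner_Integration.integrable_bound)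
  show "integrable M (\<lambda>\<omega>. 2 * (norm (X \<omega>))\<^sup>2 + 2 * (norm (Y \<omega>))\<^sup>2)"
    using assms by simp
  show "AE \<omega> in M. norm ((norm (X \<omega> + Y \<omega>))\<^sup>2) \<le> norm (2 * (norm (X \<omega>))\<^sup>2 + 2 * (norm (Y \<omega>))\<^sup>2)"
    using norm_add_sq_le_Young[of 1] by auto
qed measurable

text \<open>Minkowski's inequality. The weight \<open>q / p\<close> turns Young's bound into exactly
  \<open>(p + q)\<^sup>2\<close>; the slack \<open>e\<close> keeps \<open>p\<close> and
  \<open>q\<close> positive when \<open>a\<close> or \<open>b\<close> vanishes.\<close>

lemma l2_le_add:
  assumes X: "l2_le M X a" and Y: "l2_le M Y b"
  shows "l2_le M (\<lambda>\<omega>. X \<omega> + Y \<omega>) (a + b)"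
proof -
  note x = l2_leD[OF X] note y = l2_leD[OF Y]
  note [measurable] = x(1) y(1)
  have int: "integrable M (\<lambda>\<omega>. (norm (X \<omega> + Y \<omega>))\<^sup>2)"
    by (rule integrable_norm_add_sq[OF x(1) y(1) x(2) y(2)])
  let ?E = "\<integral>\<omega>. (norm (X \<omega> + Y \<omega>))\<^sup>2 \<partial>M"
  have "sqrt ?E \<le> (a + b) + e" if e: "e > 0" for e
  proof -
    define p q where "p = a + e / 2" and "q = b + e / 2"
    have pq: "p > 0" "q > 0" using e x(3) y(3) by (auto simp: p_def q_def)
    have "?E \<le> (\<integral>\<omega>. (1 + q / p) * (norm (X \<omega>))\<^sup>2 + (1 + 1 / (q / p)) * (norm (Y \<omega>))\<^sup>2 \<partial>M)"
      using pq x(2) y(2) int by (intro integral_mono norm_add_sq_le_Young) auto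
    also have "\<dots> = (1 + q / p) * (\<integral>\<omega>. (norm (X \<omega>))\<^sup>2 \<partial>M) + (1 + p / q) * (\<integral>\<omega>. (norm (Y \<omega>))\<^sup>2 \<partial>M)"
      using x(2) y(2) by simp
    also have "\<dots> \<le> (1 + q / p) * p\<^sup>2 + (1 + p / q) * q\<^sup>2"
    proof (intro add_mono mult_left_mono)
      show "(\<integral>\<omega>. (norm (X \<omega>))\<^sup>2 \<partial>M) \<le> p\<^sup>2"
        using x(3,4) e by (intro order_trans[OF x(4)] power_mono) (auto simp: p_def)
      show "(\<integral>\<omega>. (norm (Y \<omega>))\<^sup>2 \<partial>M) \<le> q\<^sup>2"
        using y(3,4) e by (intro order_trans[OF y(4)] power_mono) (auto simp: q_def)
    qed (use pq in auto)
    also have "\<dots> = (p + q)\<^sup>2" using pq by (simp add: field_simps power2_eq_square)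
    finally have "sqrt ?E \<le> p + q" using pq by (simp add: real_le_lsqrt)
    then show ?thesis by (simp add: p_def q_def)
  qed
  then have "sqrt ?E \<le> a + b" by (rule field_le_epsilon)
  then have "?E \<le> (a + b)\<^sup>2" by (rule sqrt_le_D)
  then show ?thesis using int x(3) y(3) by (auto simp: l2_le_def)
qed

lemma l2_le_norm_bound:
  fixes X :: "'w \<Rightarrow> 'a::euclidean_space" and Y :: "'w \<Rightarrow> 'b::euclidean_space"
  assumes X: "l2_le M X a" and [measurable]: "Y \<in> borel_measurable M"
    and le: "\<And>\<omega>. norm (Y \<omega>) \<le> c * norm (X \<omega>)" and "0 \<le> c"
  shows "l2_le M Y (c * a)"
proof -
  note x = l2_leD[OF X]
  have le2: "(norm (Y \<omega>))\<^sup>2 \<le> c\<^sup>2 * (norm (X \<omega>))\<^sup>2" for \<omega>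
    using power_mono[OF le[of \<omega>] norm_ge_zero, of 2] by (simp add: power_mult_distrib)
  have int: "integrable M (\<lambda>\<omega>. c\<^sup>2 * (norm (X \<omega>))\<^sup>2)" using x(2) by simp
  have intY: "integrable M (\<lambda>\<omega>. (norm (Y \<omega>))\<^sup>2)"
    by (rule Bochner_Integration.integrable_bound[OF int]) (use le2 in auto)
  have "(\<integral>\<omega>. (norm (Y \<omega>))\<^sup>2 \<partial>M) \<le> (\<integral>\<omega>. c\<^sup>2 * (norm (X \<omega>))\<^sup>2 \<partial>M)"
    by (rule integral_mono[OF intY int le2])
  also have "\<dots> \<le> c\<^sup>2 * a\<^sup>2" using x(4) by (simp add: mult_left_mono)
  finally show ?thesis using intY x(3) \<open>0 \<le> c\<close> by (simp add: l2_le_def power_mult_distrib)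
qed

lemma l2_le_scaleR: "l2_le M X a \<Longrightarrow> 0 \<le> c \<Longrightarrow> l2_le M (\<lambda>\<omega>. c *\<^sub>R X \<omega>) (c * a)"
  by (rule l2_le_norm_bound) (auto dest: l2_leD)

lemma l2_le_minus: "l2_le M X a \<Longrightarrow> l2_le M (\<lambda>\<omega>. - X \<omega>) a"
  using l2_le_norm_bound[of M X a "\<lambda>\<omega>. - X \<omega>" 1] by (auto dest: l2_leD)

lemma l2_le_diff: "l2_le M X a \<Longrightarrow> l2_le M Y b \<Longrightarrow> l2_le M (\<lambda>\<omega>. X \<omega> - Y \<omega>) (a + b)"
  using l2_le_add[OF _ l2_le_minus, of M X a Y b] by simp

lemma l2_le_0: "l2_le M (\<lambda>\<omega>. 0) 0"
  by (simp add: l2_le_def)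

lemma l2_le_sum:
  assumes "finite A" "\<And>i. i \<in> A \<Longrightarrow> l2_le M (X i) (a i)"
  shows "l2_le M (\<lambda>\<omega>. \<Sum>i\<in>A. X i \<omega>) (\<Sum>i\<in>A. a i)"
  using assms by (induction A rule: finite_induct) (simp_all add: l2_le_0 l2_le_add)

lemma (in prob_space) l2_le_const: "norm v \<le> c \<Longrightarrow> l2_le M (\<lambda>\<omega>. v) c"
  using order_trans[OF norm_ge_zero[of v], of c] unfolding l2_le_def
  by (auto simp: prob_space intro!: power_mono)

section \<open>Independence of a fresh sample from a sub-sigma-algebra\<close>

context prob_space
begin

text \<open>\<open>F\<close> serves only as a carrier of a sigma-algebra; measurability of the
  identity says that its sets cut out events of \<open>M\<close>. Conditional expectations are
  thereby replaced by Fubini on a product of two laws.\<close>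

definition indep_of :: "'a measure \<Rightarrow> 's measure \<Rightarrow> ('a \<Rightarrow> 's) \<Rightarrow> bool" where
  "indep_of F S Z \<longleftrightarrow> (\<lambda>\<omega>. \<omega>) \<in> measurable M F \<and> Z \<in> measurable M S \<and>
     (\<forall>A\<in>sets F. \<forall>C\<in>sets S.
       prob (A \<inter> Z -` C \<inter> space M) = prob (A \<inter> space M) * prob (Z -` C \<inter> space M))"

text \<open>The two measures agree on rectangles, where the claim is the product formula of
  \<open>indep_of\<close>. The law \<open>S\<close> of \<open>Z\<close> thus becomes the second
  factor of a genuine product measure.\<close>

lemma indep_pair_distr:
  assumes "indep_of F S Z" and law: "distr M S Z = S"
  shows "distr M F (\<lambda>\<omega>. \<omega>) \<Otimes>\<^sub>M S = distr M (F \<Otimes>\<^sub>M S) (\<lambda>\<omega>. (\<omega>, Z \<omega>))"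
    and "(\<lambda>\<omega>. \<omega>) \<in> measurable M F" and "Z \<in> measurable M S"
    and "prob_space (distr M F (\<lambda>\<omega>. \<omega>))" and "prob_space S"
proof -
  show rv: "(\<lambda>\<omega>. \<omega>) \<in> measurable M F" "Z \<in> measurable M S"
    using assms(1) by (auto simp: indep_of_def)
  show F: "prob_space (distr M F (\<lambda>\<omega>. \<omega>))" using rv(1) by (rule prob_space_distr)
  show S: "prob_space S" using prob_space_distr[OF rv(2)] law by simp
  interpret F: prob_space "distr M F (\<lambda>\<omega>. \<omega>)" by (rule F)
  interpret S: prob_space S by (rule S)
  have pm: "(\<lambda>\<omega>. (\<omega>, Z \<omega>)) \<in> measurable M (F \<Otimes>\<^sub>M S)" using rv by measurable
  show "distr M F (\<lambda>\<omega>. \<omega>) \<Otimes>\<^sub>M S = distr M (F \<Otimes>\<^sub>M S) (\<lambda>\<omega>. (\<omega>, Z \<omega>))"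
  proof (rule pair_measure_eqI)
    show "sigma_finite_measure (distr M F (\<lambda>\<omega>. \<omega>))" "sigma_finite_measure S" by unfold_locales
    show "sets (distr M F (\<lambda>\<omega>. \<omega>) \<Otimes>\<^sub>M S) = sets (distr M (F \<Otimes>\<^sub>M S) (\<lambda>\<omega>. (\<omega>, Z \<omega>)))"
      by simp
  next
    fix A C assume "A \<in> sets (distr M F (\<lambda>\<omega>. \<omega>))" and C: "C \<in> sets S"
    then have A: "A \<in> sets F" by simp
    have "emeasure (distr M F (\<lambda>\<omega>. \<omega>)) A = prob (A \<inter> space M)"
      using A rv(1) by (simp add: emeasure_distr emeasure_eq_measure)
    moreover have "emeasure S C = prob (Z -` C \<inter> space M)"
      using C rv(2) by (subst law[symmetric]) (simp add: emeasure_distr emeasure_eq_measure)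
    moreover have "(\<lambda>\<omega>. (\<omega>, Z \<omega>)) -` (A \<times> C) \<inter> space M = A \<inter> Z -` C \<inter> space M" by auto
    moreover have "prob (A \<inter> Z -` C \<inter> space M) = prob (A \<inter> space M) * prob (Z -` C \<inter> space M)"
      using assms(1) A C unfolding indep_of_def by blast
    ultimately show "emeasure (distr M F (\<lambda>\<omega>. \<omega>)) A * emeasure S C
        = emeasure (distr M (F \<Otimes>\<^sub>M S) (\<lambda>\<omega>. (\<omega>, Z \<omega>))) (A \<times> C)"
      using A C pm by (simp add: emeasure_distr emeasure_eq_measure ennreal_mult)
  qed
qed

text \<open>Every set of the generated sigma-algebra is a preimage under the restricted family, so
  independence of the families over the disjoint index sets \<open>J\<close> and \<open>{k}\<close>
  suffices.\<close>

lemma indep_of_restrict: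
  fixes \<xi> :: "'i \<Rightarrow> 'a \<Rightarrow> 's"
  assumes ind: "indep_vars D \<xi> I" and J: "J \<subseteq> I" "k \<in> I" "k \<notin> J"
  shows "indep_of (vimage_algebra (space M) (\<lambda>\<omega>. restrict (\<lambda>i. \<xi> i \<omega>) J) (PiM J D)) (D k) (\<xi> k)"
proof -
  let ?h = "\<lambda>J \<omega>. restrict (\<lambda>i. \<xi> i \<omega>) J"
  let ?F = "vimage_algebra (space M) (?h J) (PiM J D)"
  have rv: "\<xi> i \<in> measurable M (D i)" if "i \<in> I" for i
    using ind that by (auto simp: indep_vars_def)
  have hJ: "?h J \<in> measurable M (PiM J D)"
    using rv J(1) by (intro measurable_restrict) auto
  have iv: "indep_var (PiM J D) (?h J) (PiM {k} D) (?h {k})"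
    using J by (intro indep_var_restrict[OF ind]) auto
  have "(\<lambda>\<omega>. \<omega>) \<in> measurable M ?F"
    using hJ by (intro measurable_vimage_algebra2) (auto dest: measurable_space)
  moreover have "prob (A \<inter> \<xi> k -` C \<inter> space M) = prob (A \<inter> space M) * prob (\<xi> k -` C \<inter> space M)"
    if A: "A \<in> sets ?F" and C: "C \<in> sets (D k)" for A C
  proof -
    have "?h J \<in> space M \<rightarrow> space (PiM J D)" using hJ by (auto dest: measurable_space)
    from sets_vimage_algebra2[OF this] A
    obtain A' where A': "A' \<in> sets (PiM J D)" "A = ?h J -` A' \<inter> space M" by auto
    define C' where "C' = (\<lambda>x. x k) -` C \<inter> space (PiM {k} D)"
    have C': "C' \<in> sets (PiM {k} D)"
      unfolding C'_def using C by (intro measurable_sets[OF measurable_component_singleton]) auto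
    have hk: "?h {k} -` C' \<inter> space M = \<xi> k -` C \<inter> space M"
      using measurable_space[OF rv[OF J(2)]] by (auto simp: C'_def space_PiM)
    have "(\<lambda>x. (?h J x, ?h {k} x)) -` (A' \<times> C') \<inter> space M
        = (?h J -` A' \<inter> space M) \<inter> (?h {k} -` C' \<inter> space M)" by auto
    then show ?thesis using indep_varD[OF iv A'(1) C']
      unfolding hk A'(2) by (simp add: Int_ac)
  qed
  ultimately show ?thesis using rv[OF J(2)] by (auto simp: indep_of_def)
qed

text \<open>Freezing: with \<open>U\<close> known from \<open>F\<close>, the sample is integrated
  out first and the inner integral is at most \<open>c\<^sup>2\<close> for every frozen value.
  Nonnegative integrals are used because integrability over \<open>M\<close> is part of the
  claim.\<close>

lemma indep_second_moment_le:
  fixes h :: "'b \<Rightarrow> 's \<Rightarrow> 'c::euclidean_space"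
  assumes ind: "indep_of F S Z" and law: "distr M S Z = S"
    and U: "U \<in> measurable F N"
    and h: "(\<lambda>(x, s). h x s) \<in> borel_measurable (N \<Otimes>\<^sub>M S)"
    and int: "\<And>x. x \<in> space N \<Longrightarrow> integrable S (\<lambda>s. (norm (h x s))\<^sup>2)"
    and le: "\<And>x. x \<in> space N \<Longrightarrow> (\<integral>s. (norm (h x s))\<^sup>2 \<partial>S) \<le> c\<^sup>2" and "0 \<le> c"
  shows "l2_le M (\<lambda>\<omega>. h (U \<omega>) (Z \<omega>)) c"
proof -
  note P = indep_pair_distr[OF ind law]
  note [measurable] = U h P(2,3)
  let ?F = "distr M F (\<lambda>\<omega>. \<omega>)"
  interpret F: prob_space ?F by (rule P(4))
  interpret S: prob_space S by (rule P(5))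
  interpret FS: pair_prob_space ?F S ..
  have hU: "(\<lambda>z. h (U (fst z)) (snd z)) \<in> borel_measurable (F \<Otimes>\<^sub>M S)"
  proof -
    have "(\<lambda>z. (U (fst z), snd z)) \<in> measurable (F \<Otimes>\<^sub>M S) (N \<Otimes>\<^sub>M S)" by measurable
    from measurable_compose[OF this h] show ?thesis by simp
  qed
  note [measurable] = hU
  have pm: "(\<lambda>\<omega>. (\<omega>, Z \<omega>)) \<in> measurable M (F \<Otimes>\<^sub>M S)" by measurable
  have meas: "(\<lambda>\<omega>. h (U \<omega>) (Z \<omega>)) \<in> borel_measurable M"
    using measurable_compose[OF pm hU] by simp
  have "(\<integral>\<^sup>+\<omega>. ennreal ((norm (h (U \<omega>) (Z \<omega>)))\<^sup>2) \<partial>M)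
      = (\<integral>\<^sup>+z. ennreal ((norm (h (U (fst z)) (snd z)))\<^sup>2) \<partial>distr M (F \<Otimes>\<^sub>M S) (\<lambda>\<omega>. (\<omega>, Z \<omega>)))"
    by (subst nn_integral_distr[OF pm]) auto
  also have "\<dots> = (\<integral>\<^sup>+\<omega>. \<integral>\<^sup>+s. ennreal ((norm (h (U \<omega>) s))\<^sup>2) \<partial>S \<partial>?F)"
    unfolding P(1)[symmetric] by (subst S.nn_integral_fst[symmetric]) auto
  also have "\<dots> \<le> (\<integral>\<^sup>+\<omega>. ennreal (c\<^sup>2) \<partial>?F)"
  proof (rule nn_integral_mono)
    fix \<omega> assume "\<omega> \<in> space ?F"
    then have "U \<omega> \<in> space N" using measurable_space[OF U] by simp
    then show "(\<integral>\<^sup>+s. ennreal ((norm (h (U \<omega>) s))\<^sup>2) \<partial>S) \<le> ennreal (c\<^sup>2)"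
      using int le by (subst nn_integral_eq_integral) (auto intro!: ennreal_leI)
  qed
  also have "\<dots> = ennreal (c\<^sup>2)" using F.emeasure_space_1 by simp
  finally have nn: "(\<integral>\<^sup>+\<omega>. ennreal ((norm (h (U \<omega>) (Z \<omega>)))\<^sup>2) \<partial>M) \<le> ennreal (c\<^sup>2)" .
  have i: "integrable M (\<lambda>\<omega>. (norm (h (U \<omega>) (Z \<omega>)))\<^sup>2)"
    using meas le_less_trans[OF nn] by (intro integrableI_bounded) auto
  have "(\<integral>\<omega>. (norm (h (U \<omega>) (Z \<omega>)))\<^sup>2 \<partial>M) \<le> c\<^sup>2"
    using nn i by (subst (asm) nn_integral_eq_integral) auto
  then show ?thesis using meas i \<open>0 \<le> c\<close> by (auto simp: l2_le_def)
qed

lemma integrable_inner_l2: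
  fixes X Y :: "'a \<Rightarrow> 'c::euclidean_space"
  assumes X: "l2_le M X a" and Y: "l2_le M Y b"
  shows "integrable M (\<lambda>\<omega>. X \<omega> \<bullet> Y \<omega>)"
proof (rule Bochner_Integration.integrable_bound)
  show "integrable M (\<lambda>\<omega>. (norm (X \<omega>))\<^sup>2 + (norm (Y \<omega>))\<^sup>2)"
    using l2_leD(2)[OF X] l2_leD(2)[OF Y] by simp
  show "AE \<omega> in M. norm (X \<omega> \<bullet> Y \<omega>) \<le> norm ((norm (X \<omega>))\<^sup>2 + (norm (Y \<omega>))\<^sup>2)"
  proof (rule AE_I2)
    fix \<omega>
    have "\<bar>X \<omega> \<bullet> Y \<omega>\<bar> \<le> norm (X \<omega>) * norm (Y \<omega>)" by (rule Cauchy_Schwarz_ineq2)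
    also have "\<dots> \<le> (norm (X \<omega>))\<^sup>2 + (norm (Y \<omega>))\<^sup>2"
      using sum_squares_bound[of "norm (X \<omega>)" "norm (Y \<omega>)"]
        mult_nonneg_nonneg[OF norm_ge_zero[of "X \<omega>"] norm_ge_zero[of "Y \<omega>"]] by linarith
    finally show "norm (X \<omega> \<bullet> Y \<omega>) \<le> norm ((norm (X \<omega>))\<^sup>2 + (norm (Y \<omega>))\<^sup>2)" by simp
  qed
qed (intro borel_measurable_inner l2_leD(1)[OF X] l2_leD(1)[OF Y])

text \<open>After Fubini the inner integral is \<open>W \<omega>\<close> against a mean of zero.
  Unlike in the second moment bound, integrability is available here, from Cauchy-Schwarz and the
  two mean square bounds.\<close>

lemma indep_inner_centered:
  fixes h :: "'b \<Rightarrow> 's \<Rightarrow> 'c::euclidean_space"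
  assumes ind: "indep_of F S Z" and law: "distr M S Z = S"
    and U: "U \<in> measurable F N" and W: "W \<in> borel_measurable F"
    and h: "(\<lambda>(x, s). h x s) \<in> borel_measurable (N \<Otimes>\<^sub>M S)"
    and l2W: "l2_le M W a" and l2h: "l2_le M (\<lambda>\<omega>. h (U \<omega>) (Z \<omega>)) c"
    and mean: "\<And>x. x \<in> space N \<Longrightarrow> has_bochner_integral S (h x) 0"
  shows "(\<integral>\<omega>. W \<omega> \<bullet> h (U \<omega>) (Z \<omega>) \<partial>M) = 0"
proof -
  note P = indep_pair_distr[OF ind law]
  note [measurable] = U W h P(2,3)
  let ?F = "distr M F (\<lambda>\<omega>. \<omega>)"
  interpret F: prob_space ?F by (rule P(4))
  interpret S: prob_space S by (rule P(5))
  interpret FS: pair_prob_space ?F S ..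
  have hU: "(\<lambda>z. h (U (fst z)) (snd z)) \<in> borel_measurable (F \<Otimes>\<^sub>M S)"
  proof -
    have "(\<lambda>z. (U (fst z), snd z)) \<in> measurable (F \<Otimes>\<^sub>M S) (N \<Otimes>\<^sub>M S)" by measurable
    from measurable_compose[OF this h] show ?thesis by simp
  qed
  note [measurable] = hU
  have pm: "(\<lambda>\<omega>. (\<omega>, Z \<omega>)) \<in> measurable M (F \<Otimes>\<^sub>M S)" by measurable
  let ?k = "\<lambda>z. W (fst z) \<bullet> h (U (fst z)) (snd z)"
  have k: "?k \<in> borel_measurable (F \<Otimes>\<^sub>M S)" by measurable
  have "integrable (distr M (F \<Otimes>\<^sub>M S) (\<lambda>\<omega>. (\<omega>, Z \<omega>))) ?k"
    using integrable_inner_l2[OF l2W l2h] by (subst integrable_distr_eq[OF pm k]) simp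
  then have ik: "integrable (?F \<Otimes>\<^sub>M S) ?k" unfolding P(1) .
  have "(\<integral>\<omega>. W \<omega> \<bullet> h (U \<omega>) (Z \<omega>) \<partial>M) = integral\<^sup>L (distr M (F \<Otimes>\<^sub>M S) (\<lambda>\<omega>. (\<omega>, Z \<omega>))) ?k"
    by (subst integral_distr[OF pm k]) simp
  also have "\<dots> = (\<integral>\<omega>. \<integral>s. W \<omega> \<bullet> h (U \<omega>) s \<partial>S \<partial>?F)"
    unfolding P(1)[symmetric] using FS.integral_fst'[OF ik] by simp
  also have "\<dots> = (\<integral>\<omega>. 0 \<partial>?F)"
  proof (rule Bochner_Integration.integral_cong[OF refl])
    fix \<omega> assume "\<omega> \<in> space ?F"
    then have "U \<omega> \<in> space N" using measurable_space[OF U] by simp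
    from mean[OF this] have "has_bochner_integral S (\<lambda>s. W \<omega> \<bullet> h (U \<omega>) s) (W \<omega> \<bullet> 0)"
      by (rule has_bochner_integral_inner_right)
    then show "(\<integral>s. W \<omega> \<bullet> h (U \<omega>) s \<partial>S) = 0" by (simp add: has_bochner_integral_iff)
  qed
  finally show ?thesis by simp
qed

end

text \<open>Pythagoras in place of Minkowski: variances add up instead of standard deviations, which
  is where averaging over \<open>n\<close> agents gains its factor \<open>1 / n\<close>.\<close>

lemma (in prob_space) l2_le_add_orthogonal:
  assumes X: "l2_le M X a" and Y: "l2_le M Y b" and orth: "(\<integral>\<omega>. X \<omega> \<bullet> Y \<omega> \<partial>M) = 0"
  shows "l2_le M (\<lambda>\<omega>. X \<omega> + Y \<omega>) (sqrt (a\<^sup>2 + b\<^sup>2))"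
proof -
  have eq: "(norm (X \<omega> + Y \<omega>))\<^sup>2 = (norm (X \<omega>))\<^sup>2 + 2 * (X \<omega> \<bullet> Y \<omega>) + (norm (Y \<omega>))\<^sup>2" for \<omega>
    unfolding power2_norm_eq_inner by (simp add: inner_add_left inner_add_right inner_commute)
  have "(\<integral>\<omega>. (norm (X \<omega> + Y \<omega>))\<^sup>2 \<partial>M) = (\<integral>\<omega>. (norm (X \<omega>))\<^sup>2 \<partial>M) + (\<integral>\<omega>. (norm (Y \<omega>))\<^sup>2 \<partial>M)"
    unfolding eq using l2_leD(2)[OF X] l2_leD(2)[OF Y] integrable_inner_l2[OF X Y] orth by simp
  then show ?thesis
    using l2_leD[OF l2_le_add[OF X Y]] l2_leD(4)[OF X] l2_leD(4)[OF Y] by (simp add: l2_le_def)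
qed

section \<open>Gradients of strongly convex functions\<close>

text \<open>\<open>gradient\<close> is a definite description, so both existence and uniqueness are
  due: the derivative is represented by its values on the basis, and two representing vectors agree
  when tested against their difference.\<close>

lemma gderiv_gradient:
  fixes f :: "'a::euclidean_space \<Rightarrow> real"
  assumes "f differentiable (at x)"
  shows "GDERIV f x :> gradient f x"
proof -
  obtain f' where f': "(f has_derivative f') (at x)" using assms by (auto simp: differentiable_def)
  then have "linear f'" by (rule has_derivative_linear)
  define D where "D = (\<Sum>b\<in>Basis. f' b *\<^sub>R b)"
  have "f' = (\<lambda>h. h \<bullet> D)"
  proof
    fix h
    have "f' h = f' (\<Sum>b\<in>Basis. (h \<bullet> b) *\<^sub>R b)" by (simp add: euclidean_representation)
    also have "\<dots> = (\<Sum>b\<in>Basis. (h \<bullet> b) * f' b)"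
      using \<open>linear f'\<close> by (simp add: linear_sum linear_scale)
    finally show "f' h = h \<bullet> D" by (simp add: D_def inner_sum_right mult.commute)
  qed
  then have D: "GDERIV f x :> D" using f' by (simp add: gderiv_def)
  have "E = D" if "GDERIV f x :> E" for E
  proof -
    have "(\<lambda>h. h \<bullet> E) = (\<lambda>h. h \<bullet> D)"
      using that D unfolding gderiv_def by (rule has_derivative_unique)
    then have "(E - D) \<bullet> E = (E - D) \<bullet> D" by metis
    then have "(E - D) \<bullet> (E - D) = 0" by (simp add: inner_diff_right)
    then show ?thesis by simp
  qed
  with D show ?thesis unfolding gradient_def by (rule theI)
qed

lemma gradient_eqI:
  fixes f :: "'a::euclidean_space \<Rightarrow> real"
  assumes "GDERIV f x :> D"
  shows "gradient f x = D"
proof -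
  have "f differentiable (at x)" using assms by (auto simp: gderiv_def differentiable_def)
  from gderiv_gradient[OF this] have "(\<lambda>h. h \<bullet> gradient f x) = (\<lambda>h. h \<bullet> D)"
    using assms unfolding gderiv_def by (rule has_derivative_unique)
  then have "(gradient f x - D) \<bullet> gradient f x = (gradient f x - D) \<bullet> D" by metis
  then have "(gradient f x - D) \<bullet> (gradient f x - D) = 0" by (simp add: inner_diff_right)
  then show ?thesis by simp
qed

lemma gderiv_average_objective:
  fixes f :: "nat \<Rightarrow> 'a::euclidean_space \<Rightarrow> real"
  assumes "\<And>i. i \<in> {1..n} \<Longrightarrow> f i differentiable (at x)"
  shows "GDERIV (average_objective n f) x :> (1 / real n) *\<^sub>R (\<Sum>i\<in>{1..n}. gradient (f i) x)"
proof -
  have "((\<lambda>x. 1 / real n * (\<Sum>i\<in>{1..n}. f i x)) has_derivative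
      (\<lambda>h. 1 / real n * (\<Sum>i\<in>{1..n}. h \<bullet> gradient (f i) x))) (at x)"
    using gderiv_gradient[OF assms] unfolding gderiv_def
    by (intro has_derivative_mult_right has_derivative_sum) auto
  then show ?thesis unfolding gderiv_def
    by (simp add: average_objective_def[abs_def] inner_sum_right)
qed

lemma strongly_convex_gradient_monotone:
  assumes "strongly_convex \<mu> f"
  shows "\<mu> * (norm (x - y))\<^sup>2 \<le> (gradient f x - gradient f y) \<bullet> (x - y)"
proof -
  have "f y \<ge> f x + gradient f x \<bullet> (y - x) + \<mu> / 2 * (norm (x - y))\<^sup>2"
    "f x \<ge> f y + gradient f y \<bullet> (x - y) + \<mu> / 2 * (norm (x - y))\<^sup>2"
    using assms unfolding strongly_convex_def by (metis norm_minus_commute)+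
  then have "\<mu> * (norm (x - y))\<^sup>2 \<le> - (gradient f x \<bullet> (y - x)) - gradient f y \<bullet> (x - y)" by simp
  also have "\<dots> = (gradient f x - gradient f y) \<bullet> (x - y)"
    by (simp add: inner_diff_left inner_diff_right)
  finally show ?thesis .
qed

text \<open>Strong monotonicity and the Lipschitz bound are compared on one unit vector and the
  origin. The result says that the condition number is at least 1.\<close>

lemma strongly_convex_le_Lipschitz:
  fixes f :: "'a::euclidean_space \<Rightarrow> real"
  assumes "strongly_convex \<mu> f" and "L-lipschitz_on UNIV (gradient f)"
  shows "\<mu> \<le> L"
proof -
  obtain b :: 'a where b: "b \<in> Basis" using nonempty_Basis by blast
  have "\<mu> * (norm (b - 0))\<^sup>2 \<le> (gradient f b - gradient f 0) \<bullet> (b - 0)"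
    using assms(1) by (rule strongly_convex_gradient_monotone)
  also have "\<dots> \<le> norm (gradient f b - gradient f 0) * norm (b - 0)" by (rule norm_cauchy_schwarz)
  also have "\<dots> \<le> L * norm (b - 0) * norm (b - 0)"
    using lipschitz_onD[OF assms(2), of b 0] by (intro mult_right_mono) (auto simp: dist_norm)
  finally show ?thesis using b by simp
qed

text \<open>Beyond radius \<open>R\<close> the quadratic term outweighs the linear one, so values
  there are at least \<open>f 0\<close>, and the minimum over a compact ball is global.\<close>

lemma strongly_convex_attains_min:
  fixes f :: "'a::euclidean_space \<Rightarrow> real"
  assumes sc: "strongly_convex \<mu> f" and "\<mu> > 0" and cont: "continuous_on UNIV f"
  shows "\<exists>x. \<forall>y. f x \<le> f y"
proof -
  define R where "R = 2 * norm (gradient f 0) / \<mu>"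
  have R: "R \<ge> 0" using \<open>\<mu> > 0\<close> by (simp add: R_def)
  have "cball 0 R \<noteq> ({} :: 'a set)" using R by simp
  then obtain x where x: "x \<in> cball 0 R" "\<forall>y\<in>cball 0 R. f x \<le> f y"
    using continuous_attains_inf[OF compact_cball, of 0 R f] continuous_on_subset[OF cont] by blast
  have "f x \<le> f y" for y
  proof (cases "y \<in> cball 0 R")
    case False
    then have ny: "norm y > R" by simp
    have "f y \<ge> f 0 + gradient f 0 \<bullet> (y - 0) + \<mu> / 2 * (norm (y - 0))\<^sup>2"
      using sc unfolding strongly_convex_def by blast
    moreover have "gradient f 0 \<bullet> y \<ge> - (norm (gradient f 0) * norm y)"
      using Cauchy_Schwarz_ineq2[of "gradient f 0" y] by linarith
    moreover have "\<mu> / 2 * (norm y)\<^sup>2 \<ge> norm (gradient f 0) * norm y"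
    proof -
      have "\<mu> / 2 * norm y \<ge> norm (gradient f 0)"
        using ny \<open>\<mu> > 0\<close> by (simp add: R_def field_simps)
      then have "\<mu> / 2 * norm y * norm y \<ge> norm (gradient f 0) * norm y"
        by (rule mult_right_mono) simp
      then show ?thesis by (simp add: power2_eq_square mult.assoc)
    qed
    ultimately have "f y \<ge> f 0" by simp
    moreover have "f x \<le> f 0" using x(2) R by simp
    ultimately show ?thesis by simp
  qed (use x in blast)
  then show ?thesis by blast
qed

text \<open>\<open>ARG_MIN\<close> is a choice operator and says something about \<open>f\<close>
  only once a minimizer is known to exist.\<close>

lemma gradient_arg_min_strongly_convex:
  fixes f :: "'a::euclidean_space \<Rightarrow> real"
  assumes sc: "strongly_convex \<mu> f" and "\<mu> > 0" and diff: "\<And>x. f differentiable (at x)"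
  shows "gradient f (ARG_MIN f x. True) = 0"
proof -
  let ?z = "ARG_MIN f x. True"
  have "continuous_on UNIV f"
    using diff by (simp add: continuous_on_eq_continuous_within differentiable_imp_continuous_within)
  from strongly_convex_attains_min[OF sc \<open>\<mu> > 0\<close> this]
  obtain x where "\<forall>y. f x \<le> f y" by blast
  then have "is_arg_min f (\<lambda>x. True) x" by (simp add: is_arg_min_linorder)
  then have "is_arg_min f (\<lambda>x. True) ?z" unfolding arg_min_def by (rule someI)
  then have min: "f ?z \<le> f y" for y by (simp add: is_arg_min_linorder)
  have "(\<lambda>h. h \<bullet> gradient f ?z) = (\<lambda>v. 0)"
    using gderiv_gradient[OF diff[of ?z]] min unfolding gderiv_def
    by (intro differential_zero_maxmin[of ?z UNIV f]) auto
  then have "gradient f ?z \<bullet> gradient f ?z = 0" by metis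
  then show ?thesis by simp
qed

text \<open>\<open>w\<close> is the distance vector to the minimizer and \<open>q\<close> the true
  gradient. The two errors get different Young weights: \<open>e1\<close> comes at every step and
  must have the small factor \<open>4 * \<eta> / \<mu>\<close>, hence the weight
  \<open>x / 2\<close>; \<open>e2\<close> occurs only during start-up, so the weight
  \<open>x / 10\<close> saves contraction at the price of a larger factor.\<close>

lemma perturbed_gradient_step:
  fixes w q e1 e2 :: "'a::real_inner"
  assumes q: "\<mu> * (norm w)\<^sup>2 \<le> w \<bullet> q" "norm q \<le> L * norm w"
    and pos: "0 < \<mu>" "0 < \<eta>" and small: "\<eta> * L\<^sup>2 \<le> \<mu> / 100" "\<eta> * \<mu> \<le> 1 / 100"
  shows "(norm (w - \<eta> *\<^sub>R q - \<eta> *\<^sub>R e1 - \<eta> *\<^sub>R e2))\<^sup>2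
    \<le> (1 - 13 / 10 * (\<eta> * \<mu>)) * (norm w)\<^sup>2 + 4 * \<eta> / \<mu> * (norm e1)\<^sup>2
      + (1 + 10 / (\<eta> * \<mu>)) * \<eta>\<^sup>2 * (norm e2)\<^sup>2"
proof -
  define x where "x = \<eta> * \<mu>"
  have x: "0 < x" "x \<le> 1 / 100" using pos small by (auto simp: x_def)
  define p where "p = (norm w)\<^sup>2"
  have p: "p \<ge> 0" by (simp add: p_def)
  have "(norm (w - \<eta> *\<^sub>R q))\<^sup>2 = p - 2 * \<eta> * (w \<bullet> q) + \<eta>\<^sup>2 * (norm q)\<^sup>2"
    unfolding p_def power2_norm_eq_inner
    by (simp add: inner_diff_left inner_diff_right inner_commute algebra_simps power2_eq_square)
  also have "\<dots> \<le> p - 2 * \<eta> * (\<mu> * p) + \<eta> * (\<mu> / 100 * p)"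
  proof -
    have "2 * \<eta> * (\<mu> * p) \<le> 2 * \<eta> * (w \<bullet> q)" using q(1) pos by (simp add: p_def)
    moreover have "\<eta>\<^sup>2 * (norm q)\<^sup>2 \<le> \<eta> * (\<mu> / 100 * p)"
    proof -
      have "(norm q)\<^sup>2 \<le> (L * norm w)\<^sup>2" by (rule power_mono[OF q(2)]) simp
      then have "\<eta>\<^sup>2 * (norm q)\<^sup>2 \<le> \<eta>\<^sup>2 * (L\<^sup>2 * p)" by (simp add: p_def power_mult_distrib mult_left_mono)
      also have "\<dots> = \<eta> * ((\<eta> * L\<^sup>2) * p)" by (simp add: power2_eq_square)
      also have "\<dots> \<le> \<eta> * (\<mu> / 100 * p)"
        using small(1) pos p by (intro mult_left_mono mult_right_mono) auto
      finally show ?thesis .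
    qed
    ultimately show ?thesis by linarith
  qed
  also have "\<dots> = (1 - 199 / 100 * x) * p" by (simp add: x_def algebra_simps)
  finally have u: "(norm (w - \<eta> *\<^sub>R q))\<^sup>2 \<le> (1 - 199 / 100 * x) * p" .
  have "(norm (w - \<eta> *\<^sub>R q - \<eta> *\<^sub>R e1))\<^sup>2
      \<le> (1 + x / 2) * (norm (w - \<eta> *\<^sub>R q))\<^sup>2 + (1 + 1 / (x / 2)) * (norm (\<eta> *\<^sub>R e1))\<^sup>2"
    using norm_add_sq_le_Young[of "x / 2" "w - \<eta> *\<^sub>R q" "- (\<eta> *\<^sub>R e1)"] x by simp
  also have "\<dots> \<le> (1 + x / 2) * ((1 - 199 / 100 * x) * p) + 3 * \<eta> / \<mu> * (norm e1)\<^sup>2"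
  proof (rule add_mono)
    show "(1 + x / 2) * (norm (w - \<eta> *\<^sub>R q))\<^sup>2 \<le> (1 + x / 2) * ((1 - 199 / 100 * x) * p)"
      using u x by (intro mult_left_mono) auto
    have "(1 + 1 / (x / 2)) * \<eta>\<^sup>2 \<le> 3 / x * \<eta>\<^sup>2"
      using x by (intro mult_right_mono) (auto simp: field_simps)
    also have "\<dots> = 3 * \<eta> / \<mu>" using pos by (simp add: x_def power2_eq_square field_simps)
    finally have "(1 + 1 / (x / 2)) * \<eta>\<^sup>2 * (norm e1)\<^sup>2 \<le> 3 * \<eta> / \<mu> * (norm e1)\<^sup>2"
      by (rule mult_right_mono) simp
    then show "(1 + 1 / (x / 2)) * (norm (\<eta> *\<^sub>R e1))\<^sup>2 \<le> 3 * \<eta> / \<mu> * (norm e1)\<^sup>2"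
      by (simp add: power_mult_distrib mult.assoc)
  qed
  finally have v: "(norm (w - \<eta> *\<^sub>R q - \<eta> *\<^sub>R e1))\<^sup>2
      \<le> (1 + x / 2) * ((1 - 199 / 100 * x) * p) + 3 * \<eta> / \<mu> * (norm e1)\<^sup>2" .
  have "(norm (w - \<eta> *\<^sub>R q - \<eta> *\<^sub>R e1 - \<eta> *\<^sub>R e2))\<^sup>2
      \<le> (1 + x / 10) * (norm (w - \<eta> *\<^sub>R q - \<eta> *\<^sub>R e1))\<^sup>2 + (1 + 1 / (x / 10)) * (norm (\<eta> *\<^sub>R e2))\<^sup>2"
    using norm_add_sq_le_Young[of "x / 10" "w - \<eta> *\<^sub>R q - \<eta> *\<^sub>R e1" "- (\<eta> *\<^sub>R e2)"] x by simp
  also have "\<dots> = (1 + x / 10) * (norm (w - \<eta> *\<^sub>R q - \<eta> *\<^sub>R e1))\<^sup>2 + (1 + 10 / x) * \<eta>\<^sup>2 * (norm e2)\<^sup>2"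
    by (simp add: power_mult_distrib)
  finally have total: "(norm (w - \<eta> *\<^sub>R q - \<eta> *\<^sub>R e1 - \<eta> *\<^sub>R e2))\<^sup>2 \<le> \<dots>" .
  have "(1 + x / 10) * (norm (w - \<eta> *\<^sub>R q - \<eta> *\<^sub>R e1))\<^sup>2
      \<le> (1 + x / 10) * ((1 + x / 2) * ((1 - 199 / 100 * x) * p) + 3 * \<eta> / \<mu> * (norm e1)\<^sup>2)"
    using v x by (intro mult_left_mono) auto
  also have "\<dots> = ((1 + x / 10) * (1 + x / 2) * (1 - 199 / 100 * x)) * p
      + (1 + x / 10) * 3 * (\<eta> / \<mu> * (norm e1)\<^sup>2)"
  proof -
    have "c * (u * (v * p) + 3 * \<eta> / \<mu> * e) = (c * u * v) * p + c * 3 * (\<eta> / \<mu> * e)" for c u v e :: real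
      by (simp add: algebra_simps)
    then show ?thesis .
  qed
  also have "\<dots> \<le> (1 - 13 / 10 * x) * p + 4 * (\<eta> / \<mu> * (norm e1)\<^sup>2)"
  proof (intro add_mono mult_right_mono p)
    \<comment> \<open>To first order the rate is 199/100 - 1/2 - 1/10 = 139/100; the higher order
      terms are negative.\<close>
    have "(1 + x / 10) * (1 + x / 2) * (1 - 199 / 100 * x)
        = 1 - 139 / 100 * x - 1144 / 1000 * x\<^sup>2 - 995 / 10000 * (x\<^sup>2 * x)"
      by (simp add: field_simps power2_eq_square)
    also have "\<dots> \<le> 1 - 13 / 10 * x"
    proof -
      have "0 \<le> x\<^sup>2" "0 \<le> x\<^sup>2 * x" using x by auto
      then show ?thesis using x by linarith
    qed
    finally show "(1 + x / 10) * (1 + x / 2) * (1 - 199 / 100 * x) \<le> 1 - 13 / 10 * x" .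
  qed (use x pos in auto)
  finally show ?thesis using total by (simp add: x_def p_def)
qed

section \<open>The tree and the tracking recursion\<close>

text \<open>Solves \<open>B * (j - 1) + 2 \<le> i \<and> i \<le> B * j + 1\<close> for
  \<open>j\<close>. The root is its own parent, matching the self-loop of the pull matrix, so
  iterating never leaves the tree.\<close>

definition parent :: "nat \<Rightarrow> nat \<Rightarrow> nat" where
  "parent B i = (if i \<le> 1 then 1 else (i - 2) div B + 1)"

lemma parent_less: "2 \<le> i \<Longrightarrow> parent B i < i"
proof -
  assume "2 \<le> i"
  moreover have "(i - 2) div B \<le> i - 2" by (rule div_le_dividend)
  ultimately have "(i - 2) div B + 1 < i" by linarith
  then show ?thesis using \<open>2 \<le> i\<close> by (simp add: parent_def)
qed

lemma parent_1 [simp]: "parent B (Suc 0) = Suc 0"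
  by (simp add: parent_def)

lemma parent_ge_1: "1 \<le> parent B i"
  by (simp add: parent_def)

lemma parent_in: "i \<in> {1..n} \<Longrightarrow> parent B i \<in> {1..n}"
  using parent_less[of i B] parent_ge_1[of B i] by (cases "2 \<le> i") (auto simp: parent_def)

function depth :: "nat \<Rightarrow> nat \<Rightarrow> nat" where
  "depth B i = (if i \<le> 1 then 0 else Suc (depth B (parent B i)))"
  by auto
termination
  by (relation "Wellfounded.measure (\<lambda>(B, i). i)") (use parent_less in auto)

declare depth.simps [simp del]

lemma depth_1 [simp]: "depth B (Suc 0) = 0"
  by (simp add: depth.simps)

lemma depth_parent: "2 \<le> i \<Longrightarrow> depth B i = Suc (depth B (parent B i))"
  by (subst depth.simps) simp

lemma depth_eq_0: "1 \<le> i \<Longrightarrow> depth B i = 0 \<longleftrightarrow> i = 1"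
  by (subst depth.simps) auto

lemma funpow_parent_in: "i \<in> {1..n} \<Longrightarrow> (parent B ^^ k) i \<in> {1..n}"
proof (induction k)
  case (Suc k)
  then show ?case using parent_in[of "(parent B ^^ k) i" n B] by simp
qed simp

lemma depth_funpow_parent: "1 \<le> i \<Longrightarrow> depth B ((parent B ^^ k) i) = depth B i - k"
proof (induction k)
  case (Suc k)
  let ?j = "(parent B ^^ k) i"
  have "1 \<le> ?j" using funpow_parent_in[of i i k B] Suc.prems by simp
  then have "?j = 1 \<or> 2 \<le> ?j" by linarith
  then show ?case using Suc depth_parent[of ?j B] by auto
qed simp

text \<open>The first \<open>k + 1\<close> layers hold \<open>1 + B * s\<close> nodes if the first
  \<open>k\<close> layers hold \<open>s\<close>, so passing to the parent moves into the shorter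
  sum.\<close>

lemma depth_le:
  assumes "2 \<le> B" "1 \<le> i" "i \<le> (\<Sum>m\<le>k. B ^ m)"
  shows "depth B i \<le> k"
  using assms
proof (induction k arbitrary: i)
  case 0
  then show ?case by (simp add: depth.simps)
next
  case (Suc k)
  show ?case
  proof (cases "2 \<le> i")
    case True
    let ?s = "\<Sum>m\<le>k. B ^ m"
    have "i \<le> 1 + B * ?s"
      using Suc.prems(3) by (simp add: sum.atMost_Suc_shift sum_distrib_left del: sum.atMost_Suc)
    then have "i - 2 < B * ?s" using True by linarith
    then have "(i - 2) div B < ?s" using Suc.prems(1) by (simp add: less_mult_imp_div_less mult.commute)
    then have "parent B i \<le> ?s" using True by (simp add: parent_def)
    from Suc.IH[OF Suc.prems(1) parent_ge_1 this] show ?thesis using True by (simp add: depth_parent)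
  qed (simp add: depth.simps)
qed

lemma depth_le_of_size:
  assumes "2 \<le> B" and n: "real n \<le> (real B ^ (d + 1) - 1) / (real B - 1)" and "i \<in> {1..n}"
  shows "depth B i \<le> d"
proof -
  have "real n \<le> (\<Sum>m\<le>d. real B ^ m)"
    using n \<open>2 \<le> B\<close> geometric_sum[of "real B" "Suc d"]
    by (simp add: lessThan_Suc_atMost del: sum.lessThan_Suc)
  also have "\<dots> = real (\<Sum>m\<le>d. B ^ m)" by simp
  finally have "n \<le> (\<Sum>m\<le>d. B ^ m)" by (simp only: of_nat_le_iff)
  then show ?thesis using assms by (intro depth_le) auto
qed

section \<open>Matrix products as copying from the parent and summing over the children\<close>

lemma pull_matrix_eq:
  assumes "1 \<le> B" "1 \<le> i" "1 \<le> j"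
  shows "pull_matrix B i j = (if j = parent B i then 1 else 0)"
proof (cases "2 \<le> i")
  case True
  obtain k where j: "j = k + 1" using assms(3) by (metis le_add_diff_inverse2)
  have "(B * k + 2 \<le> i \<and> i \<le> B * (k + 1) + 1) \<longleftrightarrow> k = (i - 2) div B"
  proof -
    have "k = (i - 2) div B \<longleftrightarrow> B * k \<le> i - 2 \<and> i - 2 < B * Suc k"
    proof
      assume "k = (i - 2) div B"
      then show "B * k \<le> i - 2 \<and> i - 2 < B * Suc k"
        using times_div_less_eq_dividend[of B "i - 2"] dividend_less_times_div[of B "i - 2"] \<open>1 \<le> B\<close>
        by simp
    next
      assume "B * k \<le> i - 2 \<and> i - 2 < B * Suc k"
      then have "(i - 2) div B = k" by (intro div_nat_eqI) (simp_all add: mult.commute)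
      then show "k = (i - 2) div B" by simp
    qed
    also have "\<dots> \<longleftrightarrow> B * k + 2 \<le> i \<and> i \<le> B * (k + 1) + 1" using True by auto
    finally show ?thesis by simp
  qed
  then show ?thesis using True by (auto simp: pull_matrix_def parent_def j)
next
  case False
  then show ?thesis using assms by (auto simp: pull_matrix_def parent_def)
qed

lemma sum_pull_matrix:
  fixes v :: "nat \<Rightarrow> 'v::real_vector"
  assumes "1 \<le> B" "i \<in> {1..n}"
  shows "(\<Sum>j\<in>{1..n}. pull_matrix B i j *\<^sub>R v j) = v (parent B i)"
proof -
  have "(\<Sum>j\<in>{1..n}. pull_matrix B i j *\<^sub>R v j) = (\<Sum>j\<in>{1..n}. if j = parent B i then v j else 0)"
    using assms by (intro sum.cong) (auto simp: pull_matrix_eq)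
  also have "\<dots> = v (parent B i)" using parent_in[OF assms(2), of B] by simp
  finally show ?thesis .
qed

lemma sum_push_matrix:
  fixes v :: "nat \<Rightarrow> 'v::real_vector"
  assumes "1 \<le> B" "i \<in> {1..n}"
  shows "(\<Sum>j\<in>{1..n}. push_matrix B i j *\<^sub>R v j) = (\<Sum>j | j \<in> {1..n} \<and> parent B j = i. v j)"
proof -
  have "(\<Sum>j\<in>{1..n}. push_matrix B i j *\<^sub>R v j) = (\<Sum>j\<in>{1..n}. if parent B j = i then v j else 0)"
    using assms by (intro sum.cong) (auto simp: push_matrix_def pull_matrix_eq)
  also have "\<dots> = (\<Sum>j | j \<in> {1..n} \<and> parent B j = i. v j)"
    by (simp add: sum.inter_filter[symmetric])
  finally show ?thesis .
qed

text \<open>The descendants of \<open>i\<close>, itself included: climbing by the difference of the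
  depths ends at \<open>i\<close>.\<close>

definition subtree :: "nat \<Rightarrow> nat \<Rightarrow> nat \<Rightarrow> nat set" where
  "subtree B n i = {l \<in> {1..n}. depth B i \<le> depth B l \<and> (parent B ^^ (depth B l - depth B i)) l = i}"

lemma finite_subtree [simp]: "finite (subtree B n i)"
  by (simp add: subtree_def)

lemma subtree_subset: "subtree B n i \<subseteq> {1..n}"
  by (auto simp: subtree_def)

lemma subtree_root: "subtree B n (Suc 0) = {1..n}"
proof -
  have "(parent B ^^ depth B l) l = Suc 0" if "l \<in> {1..n}" for l
    using depth_funpow_parent[of l B "depth B l"] funpow_parent_in[OF that, of "depth B l" B] that
    by (simp add: depth_eq_0)
  then show ?thesis by (auto simp: subtree_def)
qed

lemma mem_subtree_self: "i \<in> {1..n} \<Longrightarrow> i \<in> subtree B n i"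
  by (simp add: subtree_def)

lemma depth_less_subtree:
  assumes "l \<in> subtree B n i" "l \<noteq> i"
  shows "depth B i < depth B l"
  using assms by (cases "depth B l - depth B i") (auto simp: subtree_def)

text \<open>A proper descendant of \<open>i\<close> has exactly one ancestor one level below
  \<open>i\<close>, and siblings share that level, so their subtrees partition what lies under
  \<open>i\<close>. The range \<open>{2..n}\<close> keeps the root from counting as its own
  child.\<close>

lemma sum_subtree_children:
  fixes v :: "nat \<Rightarrow> 'v::comm_monoid_add"
  assumes "i \<in> {1..n}"
  shows "(\<Sum>c | c \<in> {2..n} \<and> parent B c = i. \<Sum>l\<in>subtree B n c. v l) = (\<Sum>l\<in>subtree B n i - {i}. v l)"
proof -
  let ?C = "{c \<in> {2..n}. parent B c = i}"
  have dc: "depth B c = Suc (depth B i)" if "c \<in> ?C" for c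
    using that depth_parent[of c B] by auto
  have "(\<Sum>c\<in>?C. \<Sum>l\<in>subtree B n c. v l) = (\<Sum>l\<in>(\<Union>c\<in>?C. subtree B n c). v l)"
  proof (rule sum.UNION_disjoint[symmetric])
    show "\<forall>c\<in>?C. \<forall>c'\<in>?C. c \<noteq> c' \<longrightarrow> subtree B n c \<inter> subtree B n c' = {}"
      using dc by (auto simp: subtree_def)
  qed auto
  also have "(\<Union>c\<in>?C. subtree B n c) = subtree B n i - {i}"
  proof (intro equalityI subsetI)
    fix l assume "l \<in> (\<Union>c\<in>?C. subtree B n c)"
    then obtain c where c: "c \<in> ?C" and l: "l \<in> {1..n}" "Suc (depth B i) \<le> depth B l"
      "(parent B ^^ (depth B l - Suc (depth B i))) l = c"
      using dc by (auto simp: subtree_def)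
    have "depth B l - depth B i = Suc (depth B l - Suc (depth B i))" using l(2) by simp
    then have "(parent B ^^ (depth B l - depth B i)) l = i" using c l(3) by simp
    then show "l \<in> subtree B n i - {i}" using l by (auto simp: subtree_def)
  next
    fix l assume l: "l \<in> subtree B n i - {i}"
    then have less: "depth B i < depth B l" using depth_less_subtree[of l B n i] by simp
    define k where "k = depth B l - Suc (depth B i)"
    define c where "c = (parent B ^^ k) l"
    have k: "depth B l - depth B i = Suc k" using less by (simp add: k_def)
    have l1: "l \<in> {1..n}" and pi: "parent B c = i"
      using l k by (auto simp: subtree_def c_def)
    have cn: "c \<in> {1..n}" using funpow_parent_in[OF l1] by (simp add: c_def)
    have "depth B c = Suc (depth B i)"
      using depth_funpow_parent[of l B k] l1 less by (simp add: c_def k_def)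
    then have "c \<noteq> 1" by auto
    then have "c \<in> ?C" using cn pi by auto
    moreover have "l \<in> subtree B n c"
      using dc[OF \<open>c \<in> ?C\<close>] less l1 by (simp add: subtree_def c_def k_def)
    ultimately show "l \<in> (\<Union>c\<in>?C. subtree B n c)" by blast
  qed
  finally show ?thesis .
qed

text \<open>Node \<open>l\<close> acts at its time \<open>s\<close> on the root only at time \<open>s + depth l\<close>; \<open>virt B G l \<tau>\<close> re-indexes
  a sequence \<open>G l\<close> by this virtual time, with value \<open>0\<close> before node \<open>l\<close> has started.\<close>

definition virt :: "nat \<Rightarrow> (nat \<Rightarrow> nat \<Rightarrow> 'v::zero) \<Rightarrow> nat \<Rightarrow> nat \<Rightarrow> 'v" where
  "virt B G l \<tau> = (if \<tau> < depth B l then 0 else G l (\<tau> - depth B l))"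

context
  fixes B n :: nat and G Y :: "nat \<Rightarrow> nat \<Rightarrow> 'v::real_vector"
  assumes B: "1 \<le> B"
    and Y0: "\<And>i. i \<in> {1..n} \<Longrightarrow> Y i 0 = G i 0"
    and YSuc: "\<And>i t. i \<in> {1..n} \<Longrightarrow>
      Y i (Suc t) = (\<Sum>j\<in>{1..n}. push_matrix B i j *\<^sub>R Y j t) + G i (Suc t) - G i t"
begin

text \<open>A child is one level deeper, so its tracker at time \<open>t\<close> and that of
  \<open>i\<close> at time \<open>Suc t\<close> carry the same virtual time; this makes the
  children's sums match. At \<open>t = 0\<close> only \<open>i\<close> itself has started, and its
  predecessor value is the 0 built into \<open>virt\<close>.\<close>

lemma push_closed_form_inner:
  assumes "i \<in> {2..n}"
  shows "Y i t = (\<Sum>l\<in>subtree B n i. virt B G l (t + depth B i) - virt B G l (t + depth B i - 1))"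
  using assms
proof (induction t arbitrary: i)
  case 0
  have i: "i \<in> {1..n}" using 0 by auto
  have "(\<Sum>l\<in>subtree B n i. virt B G l (0 + depth B i) - virt B G l (0 + depth B i - 1))
      = (\<Sum>l\<in>subtree B n i. if l = i then G i 0 else 0)"
  proof (rule sum.cong[OF refl])
    fix l assume "l \<in> subtree B n i"
    then have "l \<noteq> i \<Longrightarrow> depth B i < depth B l" by (rule depth_less_subtree)
    moreover have "0 < depth B i" using 0 depth_parent[of i B] by simp
    ultimately show "virt B G l (0 + depth B i) - virt B G l (0 + depth B i - 1) = (if l = i then G i 0 else 0)"
      by (cases "l = i") (auto simp: virt_def)
  qed
  then show ?case using Y0[OF i] mem_subtree_self[OF i] by simp
next
  case (Suc t)
  have i: "i \<in> {1..n}" using Suc.prems by auto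
  let ?v = "\<lambda>l. virt B G l (Suc t + depth B i) - virt B G l (Suc t + depth B i - 1)"
  have "{j. j \<in> {1..n} \<and> parent B j = i} = {c \<in> {2..n}. parent B c = i}"
  proof -
    have "j \<noteq> 1" if "parent B j = i" for j using that Suc.prems by auto
    then show ?thesis by fastforce
  qed
  then have "Y i (Suc t) = (\<Sum>c | c \<in> {2..n} \<and> parent B c = i. Y c t) + G i (Suc t) - G i t"
    using YSuc[OF i, of t] sum_push_matrix[OF B i] by simp
  also have "(\<Sum>c | c \<in> {2..n} \<and> parent B c = i. Y c t)
      = (\<Sum>c | c \<in> {2..n} \<and> parent B c = i. \<Sum>l\<in>subtree B n c. ?v l)"
  proof (rule sum.cong[OF refl])
    fix c assume c: "c \<in> {c \<in> {2..n}. parent B c = i}"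
    then have "depth B c = Suc (depth B i)" using depth_parent[of c B] by auto
    then show "Y c t = (\<Sum>l\<in>subtree B n c. ?v l)" using Suc.IH[of c] c by simp
  qed
  also have "\<dots> = (\<Sum>l\<in>subtree B n i - {i}. ?v l)" by (rule sum_subtree_children[OF i])
  finally have "Y i (Suc t) = (\<Sum>l\<in>subtree B n i - {i}. ?v l) + G i (Suc t) - G i t" .
  also have "\<dots> = (\<Sum>l\<in>subtree B n i - {i}. ?v l) + ?v i" by (simp add: virt_def)
  also have "\<dots> = (\<Sum>l\<in>subtree B n i. ?v l)"
    using mem_subtree_self[OF i, of B] by (subst sum.remove[of _ i]) simp_all
  finally show ?case .
qed

text \<open>The self-loop makes the root keep its old tracker and add the increments sent by its
  children, so the increments telescope to full gradients.\<close>

lemma push_closed_form_root: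
  assumes "1 \<le> n"
  shows "Y 1 t = (\<Sum>l\<in>{1..n}. virt B G l t)"
proof (induction t)
  case 0
  have i: "1 \<in> {1..n}" using assms by auto
  have "(\<Sum>l\<in>{1..n}. virt B G l 0) = (\<Sum>l\<in>{1..n}. if l = 1 then G 1 0 else 0)"
    using depth_eq_0[of _ B] by (intro sum.cong refl) (auto simp: virt_def)
  then show ?case using Y0[OF i] i by simp
next
  case (Suc t)
  have i: "1 \<in> {1..n}" using assms by auto
  let ?v = "\<lambda>l. virt B G l (Suc t) - virt B G l t"
  have "{j. j \<in> {1..n} \<and> parent B j = 1} = insert 1 {c \<in> {2..n}. parent B c = 1}"
    using assms by auto
  then have "Y 1 (Suc t) = Y 1 t + (\<Sum>c | c \<in> {2..n} \<and> parent B c = 1. Y c t) + G 1 (Suc t) - G 1 t"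
    using YSuc[OF i, of t] sum_push_matrix[OF B i] by simp
  also have "(\<Sum>c | c \<in> {2..n} \<and> parent B c = 1. Y c t)
      = (\<Sum>c | c \<in> {2..n} \<and> parent B c = 1. \<Sum>l\<in>subtree B n c. ?v l)"
  proof (rule sum.cong[OF refl])
    fix c assume c: "c \<in> {c \<in> {2..n}. parent B c = 1}"
    then have "depth B c = Suc 0" using depth_parent[of c B] by auto
    then show "Y c t = (\<Sum>l\<in>subtree B n c. ?v l)" using push_closed_form_inner[of c t] c by simp
  qed
  also have "\<dots> = (\<Sum>l\<in>subtree B n 1 - {1}. ?v l)" by (rule sum_subtree_children[OF i])
  also have "Y 1 t + \<dots> + G 1 (Suc t) - G 1 t = (\<Sum>l\<in>{1..n}. virt B G l t) + (\<Sum>l\<in>{1..n}. ?v l)"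
  proof -
    have "(\<Sum>l\<in>{1..n}. ?v l) = ?v 1 + (\<Sum>l\<in>{1..n} - {1}. ?v l)"
      using i by (intro sum.remove) auto
    moreover have "?v 1 = G 1 (Suc t) - G 1 t" by (simp add: virt_def)
    ultimately have "(\<Sum>l\<in>{1..n} - {1}. ?v l) + G 1 (Suc t) - G 1 t = (\<Sum>l\<in>{1..n}. ?v l)" by simp
    then show ?thesis using Suc by (simp add: subtree_root add_diff_eq[symmetric] add.assoc)
  qed
  also have "\<dots> = (\<Sum>l\<in>{1..n}. virt B G l (Suc t))" by (simp add: sum_subtractf)
  finally show ?case .
qed

end

section \<open>The stochastic iteration\<close>

text \<open>The objectives enter through their gradient maps \<open>h\<close>: strong convexity of
  the average becomes the monotonicity \<open>mono\<close>, and minimality of \<open>xs\<close>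
  becomes the vanishing sum \<open>opt\<close>.\<close>

locale stochastic_push_pull = prob_space M for M :: "'w measure" +
  fixes B n d :: nat
    and h :: "nat \<Rightarrow> 'a::euclidean_space \<Rightarrow> 'a"
    and g :: "nat \<Rightarrow> 'a \<Rightarrow> 's \<Rightarrow> 'a"
    and D :: "nat \<Rightarrow> 's measure"
    and \<xi> :: "nat \<Rightarrow> nat \<Rightarrow> 'w \<Rightarrow> 's"
    and x0 xs :: 'a
    and \<sigma> L \<mu> \<gamma> :: real
  assumes B: "2 \<le> B" and n: "1 \<le> n" and d: "1 \<le> d"
    and depth_le_d: "\<And>i. i \<in> {1..n} \<Longrightarrow> depth B i \<le> d"
    and indep: "indep_vars (\<lambda>(i, t). D i) (\<lambda>(i, t). \<xi> i t) ({1..n} \<times> UNIV)"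
    and law: "\<And>i t. i \<in> {1..n} \<Longrightarrow> distr M (D i) (\<xi> i t) = D i"
    and g_meas: "\<And>i. i \<in> {1..n} \<Longrightarrow> (\<lambda>(x, s). g i x s) \<in> borel_measurable (borel \<Otimes>\<^sub>M D i)"
    and g_mean: "\<And>i x. i \<in> {1..n} \<Longrightarrow> has_bochner_integral (D i) (g i x) (h i x)"
    and g_var_int: "\<And>i x. i \<in> {1..n} \<Longrightarrow> integrable (D i) (\<lambda>s. (norm (g i x s - h i x))\<^sup>2)"
    and g_var: "\<And>i x. i \<in> {1..n} \<Longrightarrow> (\<integral>s. (norm (g i x s - h i x))\<^sup>2 \<partial>D i) \<le> \<sigma>\<^sup>2"
    and lip: "\<And>i. i \<in> {1..n} \<Longrightarrow> L-lipschitz_on UNIV (h i)"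
    and mono: "\<And>x y. \<mu> * (norm (x - y))\<^sup>2
      \<le> ((1 / real n) *\<^sub>R (\<Sum>i\<in>{1..n}. h i x) - (1 / real n) *\<^sub>R (\<Sum>i\<in>{1..n}. h i y)) \<bullet> (x - y)"
    and opt: "(\<Sum>i\<in>{1..n}. h i xs) = 0"
    and \<sigma>: "0 < \<sigma>" and \<mu>: "0 < \<mu>" and \<mu>L: "\<mu> \<le> L" and \<gamma>: "0 < \<gamma>"
    and step: "real n * \<gamma> \<le> \<mu> / (100 * (real d)\<^sup>2 * L\<^sup>2)"
begin

definition X :: "nat \<Rightarrow> nat \<Rightarrow> 'w \<Rightarrow> 'a" where
  "X i t \<omega> = btpp_X B n \<gamma> g x0 (\<lambda>i t. \<xi> i t \<omega>) t i"

definition Y :: "nat \<Rightarrow> nat \<Rightarrow> 'w \<Rightarrow> 'a" where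
  "Y i t \<omega> = btpp_Y B n \<gamma> g x0 (\<lambda>i t. \<xi> i t \<omega>) t i"

definition G :: "nat \<Rightarrow> nat \<Rightarrow> 'w \<Rightarrow> 'a" where
  "G i t \<omega> = g i (X i t \<omega>) (\<xi> i t \<omega>)"

text \<open>The truncated subtraction freezes \<open>XV l\<close> at \<open>x0\<close> until virtual time \<open>depth B l\<close>.\<close>

definition XV :: "nat \<Rightarrow> nat \<Rightarrow> 'w \<Rightarrow> 'a" where
  "XV l \<tau> \<omega> = X l (\<tau> - depth B l) \<omega>"

definition GV :: "nat \<Rightarrow> nat \<Rightarrow> 'w \<Rightarrow> 'a" where
  "GV l \<tau> \<omega> = virt B (\<lambda>l t. G l t \<omega>) l \<tau>"

definition HV :: "nat \<Rightarrow> nat \<Rightarrow> 'w \<Rightarrow> 'a" where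
  "HV l \<tau> \<omega> = (if \<tau> < depth B l then 0 else h l (XV l \<tau> \<omega>))"

definition noise :: "nat \<Rightarrow> nat \<Rightarrow> 'w \<Rightarrow> 'a" where
  "noise l \<tau> \<omega> = (if \<tau> < depth B l then 0
     else g l (XV l \<tau> \<omega>) (\<xi> l (\<tau> - depth B l) \<omega>) - h l (XV l \<tau> \<omega>))"

abbreviation z :: "nat \<Rightarrow> 'w \<Rightarrow> 'a" where
  "z \<equiv> X 1"

lemma GV_eq: "GV l \<tau> \<omega> = HV l \<tau> \<omega> + noise l \<tau> \<omega>"
  by (simp add: GV_def virt_def HV_def noise_def XV_def G_def)

lemma X_0: "X i 0 \<omega> = x0"
  by (simp add: X_def)

lemma X_Suc:
  assumes "i \<in> {1..n}"
  shows "X i (Suc t) \<omega> = X (parent B i) t \<omega> - \<gamma> *\<^sub>R Y (parent B i) t \<omega>"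
  unfolding X_def Y_def btpp_X.simps using B assms by (subst sum_pull_matrix) auto

lemma Y_0: "Y i 0 \<omega> = G i 0 \<omega>"
  by (simp add: Y_def G_def X_def)

lemma Y_Suc: "Y i (Suc t) \<omega>
    = (\<Sum>j\<in>{1..n}. push_matrix B i j *\<^sub>R Y j t \<omega>) + G i (Suc t) \<omega> - G i t \<omega>"
  unfolding Y_def G_def X_def by (rule btpp_Y.simps(2))

lemma Y_root: "Y 1 t \<omega> = (\<Sum>l\<in>{1..n}. GV l t \<omega>)"
  using push_closed_form_root[where Y = "\<lambda>i t. Y i t \<omega>" and G = "\<lambda>i t. G i t \<omega>" and B = B and n = n,
      OF _ Y_0 Y_Suc n] B by (simp add: GV_def)

lemma Y_inner:
  assumes "i \<in> {2..n}"
  shows "Y i t \<omega> = (\<Sum>l\<in>subtree B n i. GV l (t + depth B i) \<omega> - GV l (t + depth B i - 1) \<omega>)"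
  using push_closed_form_inner[where Y = "\<lambda>i t. Y i t \<omega>" and G = "\<lambda>i t. G i t \<omega>" and B = B and n = n,
      OF _ Y_0 Y_Suc assms] B by (simp add: GV_def)

lemma z_Suc: "z (Suc \<tau>) \<omega> = z \<tau> \<omega> - \<gamma> *\<^sub>R (\<Sum>l\<in>{1..n}. GV l \<tau> \<omega>)"
  using X_Suc[of 1 \<tau> \<omega>] Y_root[of \<tau> \<omega>] n by simp

section \<open>Adaptedness to the filtration of virtual time\<close>

definition past :: "nat \<Rightarrow> (nat \<times> nat) set" where
  "past \<tau> = {(l, u). l \<in> {1..n} \<and> u + depth B l < \<tau>}"

text \<open>The sigma-algebra generated by the samples with index in \<open>J\<close>.\<close>

definition sigma_of :: "(nat \<times> nat) set \<Rightarrow> 'w measure" where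
  "sigma_of J = vimage_algebra (space M) (\<lambda>\<omega>. restrict (\<lambda>k. (case k of (i, t) \<Rightarrow> \<xi> i t) \<omega>) J)
     (PiM J (\<lambda>(i, t). D i))"

lemma xi_measurable: "i \<in> {1..n} \<Longrightarrow> \<xi> i t \<in> measurable M (D i)"
  using indep by (auto simp: indep_vars_def)

lemma measurable_xi_sigma_of:
  assumes "J \<subseteq> {1..n} \<times> UNIV" "(l, u) \<in> J"
  shows "\<xi> l u \<in> measurable (sigma_of J) (D l)"
proof -
  let ?h = "\<lambda>\<omega>. restrict (\<lambda>k. (case k of (i, t) \<Rightarrow> \<xi> i t) \<omega>) J"
  have "?h \<in> measurable M (PiM J (\<lambda>(i, t). D i))"
    using assms(1) xi_measurable by (intro measurable_restrict) auto
  then have "?h \<in> space M \<rightarrow> space (PiM J (\<lambda>(i, t). D i))" by (auto dest: measurable_space)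
  then have "?h \<in> measurable (sigma_of J) (PiM J (\<lambda>(i, t). D i))"
    unfolding sigma_of_def by (rule measurable_vimage_algebra1)
  from measurable_compose[OF this measurable_component_singleton[OF assms(2)]]
  show ?thesis using assms(2) by simp
qed

lemma indep_sigma_of:
  assumes "J \<subseteq> {1..n} \<times> UNIV" "l \<in> {1..n}" "(l, u) \<notin> J"
  shows "indep_of (sigma_of J) (D l) (\<xi> l u)"
  using indep_of_restrict[OF indep assms(1), of "(l, u)"] assms by (simp add: sigma_of_def)

lemma sigma_of_measurableD:
  assumes J: "J \<subseteq> {1..n} \<times> UNIV" and f: "f \<in> measurable (sigma_of J) N"
  shows "f \<in> measurable M N"
proof -
  let ?h = "\<lambda>\<omega>. restrict (\<lambda>k. (case k of (i, t) \<Rightarrow> \<xi> i t) \<omega>) J"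
  have "?h \<in> measurable M (PiM J (\<lambda>(i, t). D i))"
    using J xi_measurable by (intro measurable_restrict) auto
  then have "(\<lambda>\<omega>. \<omega>) \<in> measurable M (sigma_of J)"
    unfolding sigma_of_def by (intro measurable_vimage_algebra2) (auto dest: measurable_space)
  from measurable_compose[OF this f] show ?thesis by simp
qed

lemma past_subset: "past \<tau> \<subseteq> {1..n} \<times> UNIV"
  by (auto simp: past_def)

lemma measurable_g:
  assumes "i \<in> {1..n}" "U \<in> borel_measurable N" "Z \<in> measurable N (D i)"
  shows "(\<lambda>\<omega>. g i (U \<omega>) (Z \<omega>)) \<in> borel_measurable N"
  using measurable_compose[OF measurable_Pair[OF assms(2,3)] g_meas[OF assms(1)]] by simp

lemma depth_parent_le: "i \<in> {1..n} \<Longrightarrow> i = 1 \<and> parent B i = 1 \<or> Suc (depth B (parent B i)) = depth B i"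
  using depth_parent[of i B] by (cases "i = 1") auto

text \<open>An iterate of virtual time \<open>\<tau>\<close> uses samples of strictly smaller
  virtual time, whereas a tracker also uses those of its own virtual time; hence
  \<open>\<le>\<close> for \<open>X\<close> and \<open><\<close> for \<open>Y\<close>. The set
  \<open>J\<close> may exceed \<open>past \<tau>\<close>, because the noises of time
  \<open>\<tau>\<close> are later conditioned on each other.\<close>

lemma X_Y_adapted:
  assumes J: "J \<subseteq> {1..n} \<times> UNIV" "past \<tau> \<subseteq> J"
  shows "\<forall>i\<in>{1..n}. (t + depth B i \<le> \<tau> \<longrightarrow> X i t \<in> borel_measurable (sigma_of J)) \<and>
    (t + depth B i < \<tau> \<longrightarrow> Y i t \<in> borel_measurable (sigma_of J))"
proof -
  have Gm: "G i t \<in> borel_measurable (sigma_of J)"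
    if "X i t \<in> borel_measurable (sigma_of J)" "t + depth B i < \<tau>" "i \<in> {1..n}" for i t
    unfolding G_def using that J
    by (intro measurable_g measurable_xi_sigma_of) (auto simp: past_def)
  show ?thesis
  proof (induction t)
    case 0
    have X0: "X i 0 \<in> borel_measurable (sigma_of J)" for i by (simp add: X_0[abs_def])
    have "Y i 0 = G i 0" for i by (rule ext) (rule Y_0)
    then show ?case using X0 Gm by auto
  next
    case (Suc t)
    have X: "X i (Suc t) \<in> borel_measurable (sigma_of J)" if i: "i \<in> {1..n}" "Suc t + depth B i \<le> \<tau>" for i
    proof -
      have "t + depth B (parent B i) < \<tau>" using depth_parent_le[OF i(1)] i(2) by auto
      then have "X (parent B i) t \<in> borel_measurable (sigma_of J)"
        "Y (parent B i) t \<in> borel_measurable (sigma_of J)"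
        using Suc parent_in[OF i(1), of B] by auto
      moreover have "X i (Suc t) = (\<lambda>\<omega>. X (parent B i) t \<omega> - \<gamma> *\<^sub>R Y (parent B i) t \<omega>)"
        using X_Suc[OF i(1)] by blast
      ultimately show ?thesis by simp
    qed
    have Y: "Y i (Suc t) \<in> borel_measurable (sigma_of J)" if i: "i \<in> {1..n}" "Suc t + depth B i < \<tau>" for i
    proof -
      have c: "Y j t \<in> borel_measurable (sigma_of J)" if "j \<in> {1..n}" "parent B j = i" for j
        using depth_parent_le[OF that(1)] that i(2) Suc by auto
      have G: "G i (Suc t) \<in> borel_measurable (sigma_of J)" "G i t \<in> borel_measurable (sigma_of J)"
        using Suc i X[OF i(1)] by (auto intro: Gm)
      have "Y i (Suc t) = (\<lambda>\<omega>. (\<Sum>j | j \<in> {1..n} \<and> parent B j = i. Y j t \<omega>) + G i (Suc t) \<omega> - G i t \<omega>)"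
        unfolding Y_Suc using B i(1) by (subst sum_push_matrix) auto
      then show ?thesis using c G
        by (simp only:) (intro borel_measurable_diff borel_measurable_add borel_measurable_sum; auto)
    qed
    show ?case using X Y by blast
  qed
qed

lemma X_measurable_sigma_of:
  assumes "J \<subseteq> {1..n} \<times> UNIV" "past \<tau> \<subseteq> J" "i \<in> {1..n}" "t + depth B i \<le> \<tau>"
  shows "X i t \<in> borel_measurable (sigma_of J)"
  using X_Y_adapted[OF assms(1,2)] assms(3,4) by blast

lemma XV_measurable_sigma_of:
  assumes "J \<subseteq> {1..n} \<times> UNIV" "past \<tau> \<subseteq> J" "i \<in> {1..n}"
  shows "XV i \<tau> \<in> borel_measurable (sigma_of J)"
proof (cases "depth B i \<le> \<tau>")
  case True
  then have "X i (\<tau> - depth B i) \<in> borel_measurable (sigma_of J)"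
    using assms by (intro X_measurable_sigma_of[of J \<tau>]) auto
  then show ?thesis by (simp add: XV_def[abs_def])
next
  case False
  then have "XV i \<tau> = (\<lambda>\<omega>. x0)" by (auto simp: XV_def X_0)
  then show ?thesis by simp
qed

lemma XV_measurable: "i \<in> {1..n} \<Longrightarrow> XV i \<tau> \<in> borel_measurable M"
  by (rule sigma_of_measurableD[OF past_subset XV_measurable_sigma_of[OF past_subset order_refl]])

lemma h_measurable: "i \<in> {1..n} \<Longrightarrow> h i \<in> borel_measurable borel"
  using lipschitz_on_continuous_on[OF lip] by (rule borel_measurable_continuous_onI)

lemma HV_measurable:
  assumes "i \<in> {1..n}" "XV i \<tau> \<in> borel_measurable N"
  shows "HV i \<tau> \<in> borel_measurable N"
  using measurable_compose[OF assms(2) h_measurable[OF assms(1)]]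
  by (cases "\<tau> < depth B i") (simp_all add: HV_def[abs_def])

lemma noise_measurable:
  assumes i: "i \<in> {1..n}" "XV i \<tau> \<in> borel_measurable N"
    and "depth B i \<le> \<tau> \<Longrightarrow> \<xi> i (\<tau> - depth B i) \<in> measurable N (D i)"
  shows "noise i \<tau> \<in> borel_measurable N"
  using assms measurable_compose[OF assms(2) h_measurable[OF assms(1)]]
  by (cases "\<tau> < depth B i") (auto simp: noise_def[abs_def] intro!: borel_measurable_diff measurable_g)

text \<open>The noises entering the root at virtual time \<open>\<tau>\<close> are centered given \<open>past \<tau>\<close> and given
  each other, so their variances add up.\<close>

lemma l2_le_add_noise:
  assumes A: "finite A" "A \<subseteq> {1..n}"
    and U: "\<And>J. J \<subseteq> {1..n} \<times> UNIV \<Longrightarrow> past \<tau> \<subseteq> J \<Longrightarrow> U \<in> borel_measurable (sigma_of J)"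
    and l2U: "l2_le M U c"
  shows "l2_le M (\<lambda>\<omega>. U \<omega> + (\<Sum>l\<in>A. noise l \<tau> \<omega>)) (sqrt (c\<^sup>2 + real (card A) * \<sigma>\<^sup>2))"
  using A
proof (induction A rule: finite_induct)
  case empty
  then show ?case using l2U l2_leD(3)[OF l2U] by simp
next
  case (insert m A)
  let ?W = "\<lambda>\<omega>. U \<omega> + (\<Sum>l\<in>A. noise l \<tau> \<omega>)"
  let ?c = "sqrt (c\<^sup>2 + real (card A) * \<sigma>\<^sup>2)"
  have W: "l2_le M ?W ?c" and m: "m \<in> {1..n}" and mA: "m \<notin> A" using insert by auto
  have eq: "U \<omega> + (\<Sum>l\<in>insert m A. noise l \<tau> \<omega>) = ?W \<omega> + noise m \<tau> \<omega>" for \<omega>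
    using insert(1,2) by (simp add: add_ac)
  have csq: "?c\<^sup>2 + \<sigma>\<^sup>2 = c\<^sup>2 + real (card (insert m A)) * \<sigma>\<^sup>2"
    using insert(1,2) by (simp add: algebra_simps)
  show ?case
  proof (cases "\<tau> < depth B m")
    case True
    have "?c \<le> sqrt (c\<^sup>2 + real (card (insert m A)) * \<sigma>\<^sup>2)" unfolding csq[symmetric] by simp
    then show ?thesis unfolding eq using True l2_le_mono[OF W] by (simp add: noise_def)
  next
    case False
    \<comment> \<open>All samples of virtual time at most \<open>\<tau>\<close> except the one of
      \<open>m\<close>. Each agent has at most one sample of virtual time \<open>\<tau>\<close>, so
      \<open>J\<close> still determines the noises already summed.\<close>
    define J where "J = past (Suc \<tau>) - {(m, \<tau> - depth B m)}"
    have J: "J \<subseteq> {1..n} \<times> UNIV" "past \<tau> \<subseteq> J" "(m, \<tau> - depth B m) \<notin> J"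
      using False by (auto simp: J_def past_def)
    have noise: "noise l \<tau> \<in> borel_measurable (sigma_of J)" if "l \<in> A" for l
    proof (rule noise_measurable)
      show l: "l \<in> {1..n}" using that insert by auto
      show "XV l \<tau> \<in> borel_measurable (sigma_of J)" by (rule XV_measurable_sigma_of[OF J(1,2) l])
      show "\<xi> l (\<tau> - depth B l) \<in> measurable (sigma_of J) (D l)" if "depth B l \<le> \<tau>"
        using that l \<open>l \<in> A\<close> mA by (intro measurable_xi_sigma_of[OF J(1)]) (auto simp: J_def past_def)
    qed
    let ?Z = "\<xi> m (\<tau> - depth B m)"
    let ?e = "\<lambda>x s. g m x s - h m x"
    have Wm: "?W \<in> borel_measurable (sigma_of J)"
      using U[OF J(1,2)] noise by (intro borel_measurable_add borel_measurable_sum)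
    have ind: "indep_of (sigma_of J) (D m) ?Z" by (rule indep_sigma_of[OF J(1) m J(3)])
    have lw: "distr M (D m) ?Z = D m" by (rule law[OF m])
    have XV: "XV m \<tau> \<in> borel_measurable (sigma_of J)" by (rule XV_measurable_sigma_of[OF J(1,2) m])
    have em: "(\<lambda>(x, s). ?e x s) \<in> borel_measurable (borel \<Otimes>\<^sub>M D m)"
      using g_meas[OF m] measurable_compose[OF measurable_fst h_measurable[OF m]]
      unfolding split_beta' by (rule borel_measurable_diff)
    have noise_eq: "noise m \<tau> = (\<lambda>\<omega>. ?e (XV m \<tau> \<omega>) (?Z \<omega>))"
      using False by (simp add: noise_def[abs_def])
    have e: "l2_le M (\<lambda>\<omega>. ?e (XV m \<tau> \<omega>) (?Z \<omega>)) \<sigma>"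
      using g_var_int[OF m] g_var[OF m] \<sigma> by (intro indep_second_moment_le[OF ind lw XV em]) auto
    interpret Dm: prob_space "D m" using indep_pair_distr(5)[OF ind lw] .
    have "has_bochner_integral (D m) (?e x) 0" for x
      using g_mean[OF m, of x] by (auto simp: has_bochner_integral_iff Dm.prob_space)
    then have "(\<integral>\<omega>. ?W \<omega> \<bullet> ?e (XV m \<tau> \<omega>) (?Z \<omega>) \<partial>M) = 0"
      by (intro indep_inner_centered[OF ind lw XV Wm em W e])
    from l2_le_add_orthogonal[OF W e this] show ?thesis
      unfolding eq noise_eq csq .
  qed
qed

subsection \<open>Constants\<close>

definition \<eta> where "\<eta> = real n * \<gamma>"
text \<open>The standard deviation of an average of \<open>n\<close> orthogonal noises of variance
  \<open>\<sigma>\<^sup>2\<close>.\<close>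

definition S where "S = \<sigma> / sqrt (real n)"
definition N where "N = 100 * \<eta> * S\<^sup>2 / \<mu>"
definition r where "r = 1 - \<eta> * \<mu> / 16"
definition a where "a = norm (x0 - xs)"
definition b where "b = sqrt (1 / (real n * L\<^sup>2) * (\<Sum>i\<in>{1..n}. (norm (h i x0))\<^sup>2))"
definition V where "V = a\<^sup>2 + b\<^sup>2"
text \<open>A sum of two roots rather than the root of a sum, so that passing between times
  \<open>u\<close> and \<open>u + k\<close> costs only the factor \<open>r ^ k\<close>.\<close>

definition K where "K t = r ^ t * sqrt V + sqrt N"
text \<open>The second summand of \<open>W\<close> absorbs the gradients missing at the root during the first \<open>d\<close> steps:
  they cost about \<open>b\<^sup>2 / (9 * d)\<close> per step, while \<open>W\<close> grows by \<open>b\<^sup>2 / (2 * d)\<close>.\<close>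

definition W where "W t = a\<^sup>2 + b\<^sup>2 * (1 / 4 + real (min t d) / (2 * real d))"
text \<open>The unit for displacements relative to \<open>K\<close>: one root step moves by at most
  \<open>4 * \<theta> * K\<close>, and \<open>d\<close> edges at \<open>15 * \<theta>\<close> each
  add up to \<open>15 / 100 * (\<mu> / L)\<close>.\<close>

definition \<theta> where "\<theta> = \<mu> / (100 * real d * L)"

section \<open>Consequences of the step size for the constants\<close>

lemma L_pos: "0 < L" using \<mu> \<mu>L by simp
lemma \<eta>_pos: "0 < \<eta>" using n \<gamma> by (simp add: \<eta>_def)
lemma \<theta>_pos: "0 < \<theta>" using \<mu> L_pos d by (simp add: \<theta>_def)
lemma S_pos: "0 < S" using \<sigma> n by (simp add: S_def)
lemma N_pos: "0 < N" using \<eta>_pos S_pos \<mu> by (simp add: N_def)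
lemma b_nonneg: "0 \<le> b" by (simp add: b_def sum_nonneg)
lemma b_sq: "b\<^sup>2 = 1 / (real n * L\<^sup>2) * (\<Sum>i\<in>{1..n}. (norm (h i x0))\<^sup>2)"
  by (simp add: b_def sum_nonneg)
lemma V_nonneg: "0 \<le> V" by (simp add: V_def)

lemma step': "\<eta> * L\<^sup>2 * (real d)\<^sup>2 \<le> \<mu> / 100"
  using step L_pos d by (simp add: \<eta>_def field_simps)

lemma \<eta>L2: "\<eta> * L\<^sup>2 \<le> \<mu> / (100 * (real d)\<^sup>2)"
  using step' d by (simp add: field_simps)

lemma \<eta>L_le: "\<eta> * L \<le> \<theta>"
proof -
  have "\<eta> * L\<^sup>2 * real d \<le> \<eta> * L\<^sup>2 * (real d)\<^sup>2"
    using d \<eta>_pos by (intro mult_left_mono) (auto simp: power2_eq_square)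
  then have "\<eta> * L\<^sup>2 * real d \<le> \<mu> / 100" using step' by linarith
  then show ?thesis using L_pos d by (simp add: \<theta>_def field_simps power2_eq_square)
qed

text \<open>This needs the full \<open>d\<^sup>2\<close> of the step size: noise moves a node by
  \<open>\<eta> * S\<close>, which is of order \<open>sqrt (\<eta> * \<mu> * N)\<close>, and this
  has to fit into \<open>\<theta> * sqrt N\<close> with \<open>\<theta>\<close> of order
  \<open>1 / d\<close>.\<close>

lemma \<eta>\<mu>_le_sq: "\<eta> * \<mu> \<le> 100 * \<theta>\<^sup>2"
proof -
  have "\<eta> * \<mu> \<le> \<mu> / (100 * (real d)\<^sup>2 * L\<^sup>2) * \<mu>"
    using step \<mu> by (intro mult_right_mono) (auto simp: \<eta>_def)
  also have "\<dots> = 100 * \<theta>\<^sup>2" using L_pos d by (simp add: \<theta>_def power2_eq_square field_simps)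
  finally show ?thesis .
qed

lemma \<eta>\<mu>_d: "\<eta> * \<mu> * (real d)\<^sup>2 \<le> 1 / 100"
proof -
  have "\<eta> * \<mu> * (real d)\<^sup>2 * \<mu> \<le> \<eta> * L\<^sup>2 * (real d)\<^sup>2"
  proof -
    have "\<mu>\<^sup>2 \<le> L\<^sup>2" using \<mu> \<mu>L by (intro power_mono) auto
    then have "\<mu>\<^sup>2 * (\<eta> * (real d)\<^sup>2) \<le> L\<^sup>2 * (\<eta> * (real d)\<^sup>2)"
      using \<eta>_pos by (intro mult_right_mono) auto
    then show ?thesis by (simp add: power2_eq_square mult_ac)
  qed
  then have "\<eta> * \<mu> * (real d)\<^sup>2 * \<mu> \<le> 1 / 100 * \<mu>" using step' by simp
  then show ?thesis using \<mu> by (rule mult_right_le_imp_le)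
qed

lemma \<eta>\<mu>_d1: "\<eta> * \<mu> * real d \<le> 1 / 100"
proof -
  have "\<eta> * \<mu> * real d \<le> \<eta> * \<mu> * (real d)\<^sup>2"
    using d \<eta>_pos \<mu> by (intro mult_left_mono) (auto simp: power2_eq_square)
  then show ?thesis using \<eta>\<mu>_d by linarith
qed

lemma \<eta>\<mu>_small: "\<eta> * \<mu> \<le> 1 / 100"
proof -
  have "\<eta> * \<mu> * 1 \<le> \<eta> * \<mu> * real d" using d \<eta>_pos \<mu> by (intro mult_left_mono) auto
  then show ?thesis using \<eta>\<mu>_d1 by linarith
qed

lemma r_bounds: "0 < r" "r \<le> 1"
  using \<eta>\<mu>_small \<eta>_pos \<mu> by (auto simp: r_def)

lemma \<eta>S_sq: "(\<eta> * S)\<^sup>2 = \<eta> * \<mu> * N / 100"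
  using \<mu> by (simp add: N_def power2_eq_square)

lemma \<eta>S_le: "\<eta> * S \<le> \<theta> * sqrt N"
proof (rule power2_le_imp_le)
  have "\<eta> * \<mu> * N / 100 \<le> (100 * \<theta>\<^sup>2) * N / 100"
    using \<eta>\<mu>_le_sq N_pos by (intro divide_right_mono mult_right_mono) auto
  then show "(\<eta> * S)\<^sup>2 \<le> (\<theta> * sqrt N)\<^sup>2"
    unfolding \<eta>S_sq using N_pos by (simp add: power_mult_distrib)
qed (use \<theta>_pos N_pos in simp)

lemma r_power_ge: "1 - real k * (\<eta> * \<mu>) / 16 \<le> r ^ k"
  using Bernoulli_inequality[of "- (\<eta> * \<mu> / 16)" k] \<eta>\<mu>_small by (simp add: r_def)

text \<open>By Bernoulli and \<open>\<eta> * \<mu> * d \<le> 1 / 100\<close>, the decay during the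
  longest delay \<open>2 * d\<close> is negligible.\<close>

lemma r_power_d: "999 / 1000 \<le> r ^ d" "998 / 1000 \<le> r ^ (2 * d)"
proof -
  have "real d * (\<eta> * \<mu>) \<le> 1 / 100" "real (2 * d) * (\<eta> * \<mu>) \<le> 2 / 100"
    using \<eta>\<mu>_d1 by (simp_all add: mult_ac)
  then show "999 / 1000 \<le> r ^ d" "998 / 1000 \<le> r ^ (2 * d)"
    using r_power_ge[of d] r_power_ge[of "2 * d"] by linarith+
qed

lemma K_nonneg: "0 \<le> K t"
  using r_bounds V_nonneg N_pos by (simp add: K_def)

lemma sqrt_N_le_K: "sqrt N \<le> K t"
  using r_bounds V_nonneg by (simp add: K_def)

lemma K_shift: "r ^ k * K u \<le> K (u + k)"
proof -
  have "r ^ k * sqrt N \<le> 1 * sqrt N"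
    using r_bounds N_pos by (intro mult_right_mono power_le_one) auto
  then show ?thesis by (simp add: K_def power_add algebra_simps)
qed

lemma K_decreasing: "u \<le> v \<Longrightarrow> K v \<le> K u"
  unfolding K_def using r_bounds V_nonneg by (intro add_mono mult_right_mono power_decreasing) auto

text \<open>Bounds inherited from up to \<open>m\<close> steps ago are restated at the current time;
  this is what the powers of \<open>r\<close> in \<open>node_bound\<close> pay for.\<close>

lemma K_le_divide:
  assumes "u \<le> v" "v - u \<le> m"
  shows "K u \<le> K v / r ^ m"
proof -
  have "r ^ m * K u \<le> r ^ (v - u) * K u"
    using assms r_bounds K_nonneg by (intro mult_right_mono power_decreasing) auto
  also have "\<dots> \<le> K v" using K_shift[of "v - u" u] assms by simp
  finally show ?thesis using r_bounds by (simp add: field_simps)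
qed

lemma b_le_K: "t \<le> d \<Longrightarrow> b \<le> 101 / 100 * K t"
proof -
  assume "t \<le> d"
  have "b \<le> sqrt V" unfolding V_def using b_nonneg by (simp add: real_le_rsqrt)
  also have "\<dots> \<le> 101 / 100 * (r ^ t * sqrt V)"
  proof -
    have "999 / 1000 \<le> r ^ t"
      using r_power_d(1) power_decreasing[OF \<open>t \<le> d\<close>, of r] r_bounds by linarith
    then have "1 * sqrt V \<le> 101 / 100 * r ^ t * sqrt V" using V_nonneg by (intro mult_right_mono) auto
    then show ?thesis by simp
  qed
  also have "\<dots> \<le> 101 / 100 * K t" using N_pos by (simp add: K_def)
  finally show ?thesis .
qed

lemma W_le_V: "W t \<le> V"
proof -
  have "real (min t d) / (2 * real d) \<le> 1 / 2" using d by (simp add: field_simps)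
  then have "b\<^sup>2 * (1 / 4 + real (min t d) / (2 * real d)) \<le> b\<^sup>2 * 1" by (intro mult_left_mono) auto
  then show ?thesis by (simp add: W_def V_def)
qed

lemma V_le_W: "V \<le> 4 * W t"
proof -
  have "b\<^sup>2 * (1 / 4) \<le> b\<^sup>2 * (1 / 4 + real (min t d) / (2 * real d))"
    by (intro mult_left_mono) auto
  moreover have "0 \<le> a\<^sup>2" by simp
  ultimately show ?thesis unfolding W_def V_def by argo
qed

lemma W_nonneg: "0 \<le> W t"
  using V_le_W[of t] V_nonneg by linarith

text \<open>Cauchy-Schwarz over the agents; \<open>L * b\<close> is the root mean square of the
  initial gradients.\<close>

lemma sum_grad_le:
  assumes "A \<subseteq> {1..n}"
  shows "\<gamma> * (\<Sum>l\<in>A. norm (h l x0)) \<le> \<eta> * L * b"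
proof -
  let ?s = "\<Sum>i\<in>{1..n}. norm (h i x0)" and ?q = "\<Sum>i\<in>{1..n}. (norm (h i x0))\<^sup>2"
  have "(\<Sum>l\<in>A. norm (h l x0)) \<le> ?s" using assms by (intro sum_mono2) auto
  also have "\<dots> \<le> real n * L * b"
  proof (rule power2_le_imp_le)
    have "?s\<^sup>2 \<le> real n * ?q"
      using sum_squared_le_sum_of_squares[of "\<lambda>i. norm (h i x0)" "{1..n}"] by (simp add: mult.commute)
    also have "\<dots> = (real n * L * b)\<^sup>2"
      using n L_pos by (simp add: power_mult_distrib b_sq) (simp add: power2_eq_square)
    finally show "?s\<^sup>2 \<le> (real n * L * b)\<^sup>2" .
  qed (use L_pos b_nonneg in simp)
  finally have "\<gamma> * (\<Sum>l\<in>A. norm (h l x0)) \<le> \<gamma> * (real n * L * b)"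
    using \<gamma> by (intro mult_left_mono) auto
  then show ?thesis by (simp add: \<eta>_def mult_ac)
qed

subsection \<open>Simultaneous bounds for the root and for the other nodes\<close>

definition root_bound where
  "root_bound u \<longleftrightarrow> l2_le M (\<lambda>\<omega>. z u \<omega> - xs) (sqrt (r ^ (2 * u) * W u + N))"

text \<open>Each edge costs \<open>15 * \<theta>\<close>, and a factor \<open>r\<^sup>2\<close>
  because a node at virtual time \<open>u\<close> copies its parent at virtual time
  \<open>u - 2\<close>: one step of delay in real time and one level of depth.\<close>

definition node_bound where
  "node_bound u \<longleftrightarrow> (\<forall>i\<in>{1..n}.
     l2_le M (\<lambda>\<omega>. XV i u \<omega> - z u \<omega>) (15 * \<theta> * real (depth B i) * (K u / r ^ (2 * depth B i))))"

lemma z_measurable: "z u \<in> borel_measurable M"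
  using XV_measurable[of 1 u] n by (simp add: XV_def[abs_def])

lemma root_bound_K:
  assumes "root_bound u"
  shows "l2_le M (\<lambda>\<omega>. z u \<omega> - xs) (K u)"
proof (rule l2_le_mono)
  have "r ^ (2 * u) * W u \<le> r ^ (2 * u) * V" using r_bounds W_le_V by (intro mult_left_mono) auto
  then have "sqrt (r ^ (2 * u) * W u + N) \<le> sqrt (r ^ (2 * u) * V + N)" by simp
  also have "\<dots> \<le> sqrt (r ^ (2 * u) * V) + sqrt N"
    using r_bounds V_nonneg N_pos by (intro sqrt_add_le_add_sqrt) auto
  also have "sqrt (r ^ (2 * u) * V) = r ^ u * sqrt V"
    using r_bounds by (simp add: real_sqrt_mult power_mult[of r u 2, symmetric] mult.commute[of u 2]
        real_sqrt_power power_mult real_sqrt_pow2)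
  finally show "sqrt (r ^ (2 * u) * W u + N) \<le> K u" by (simp add: K_def)
qed (use assms in \<open>simp add: root_bound_def\<close>)

text \<open>With \<open>d * \<theta> = \<mu> / (100 * L)\<close> and
  \<open>r ^ (2 * d) \<ge> 998 / 1000\<close>, the factor is 15 / 99.8, rounded up to 16 /
  100.\<close>

lemma node_bound_K:
  assumes "node_bound u" "i \<in> {1..n}"
  shows "l2_le M (\<lambda>\<omega>. XV i u \<omega> - z u \<omega>) (16 / 100 * (\<mu> / L) * K u)"
proof (rule l2_le_mono)
  show "l2_le M (\<lambda>\<omega>. XV i u \<omega> - z u \<omega>) (15 * \<theta> * real (depth B i) * (K u / r ^ (2 * depth B i)))"
    using assms by (simp add: node_bound_def)
  have "998 / 1000 \<le> r ^ (2 * depth B i)"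
    using r_power_d(2) power_decreasing[of "2 * depth B i" "2 * d" r] r_bounds depth_le_d[OF assms(2)]
    by auto
  then have "K u / r ^ (2 * depth B i) \<le> K u / (998 / 1000)"
    using K_nonneg[of u] by (intro divide_left_mono) auto
  then have "15 * \<theta> * real (depth B i) * (K u / r ^ (2 * depth B i)) \<le> 15 * \<theta> * real d * (K u / (998 / 1000))"
    using depth_le_d[OF assms(2)] \<theta>_pos K_nonneg[of u] r_bounds
    by (intro mult_mono) auto
  also have "\<dots> = 15 / (100 * (998 / 1000)) * (\<mu> / L) * K u"
    using d L_pos by (simp add: \<theta>_def)
  also have "\<dots> \<le> 16 / 100 * (\<mu> / L) * K u"
    using \<mu> L_pos K_nonneg[of u] by (intro mult_right_mono) auto
  finally show "15 * \<theta> * real (depth B i) * (K u / r ^ (2 * depth B i)) \<le> 16 / 100 * (\<mu> / L) * K u" .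
qed

section \<open>Mean square size of gradients, noises and increments\<close>

lemma h_lip: "i \<in> {1..n} \<Longrightarrow> norm (h i x - h i y) \<le> L * norm (x - y)"
  using lipschitz_onD[OF lip, of i x y] by (simp add: dist_norm)

lemma h_XV_measurable: "i \<in> {1..n} \<Longrightarrow> (\<lambda>\<omega>. h i (XV i u \<omega>)) \<in> borel_measurable M"
  by (rule measurable_compose[OF XV_measurable h_measurable])

lemma gradient_bound:
  assumes "root_bound u" "node_bound u" "i \<in> {1..n}"
  shows "l2_le M (\<lambda>\<omega>. h i (XV i u \<omega>) - h i xs) (116 / 100 * L * K u)"
proof -
  have "l2_le M (\<lambda>\<omega>. XV i u \<omega> - xs) (16 / 100 * (\<mu> / L) * K u + K u)"
    using l2_le_add[OF node_bound_K[OF assms(2,3)] root_bound_K[OF assms(1)]] by simp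
  moreover have "16 / 100 * (\<mu> / L) * K u \<le> 16 / 100 * 1 * K u"
    using \<mu>L L_pos K_nonneg[of u] by (intro mult_right_mono mult_left_mono) auto
  ultimately have "l2_le M (\<lambda>\<omega>. XV i u \<omega> - xs) (116 / 100 * K u)"
    by (elim l2_le_mono) simp
  then have "l2_le M (\<lambda>\<omega>. h i (XV i u \<omega>) - h i xs) (L * (116 / 100 * K u))"
    using h_XV_measurable[OF assms(3)] h_lip[OF assms(3)] L_pos by (elim l2_le_norm_bound) auto
  then show ?thesis by (simp add: mult_ac)
qed

lemma gradient_sum_bound:
  assumes "root_bound u" "node_bound u" "A \<subseteq> {1..n}"
  shows "l2_le M (\<lambda>\<omega>. \<gamma> *\<^sub>R (\<Sum>i\<in>A. h i (XV i u \<omega>) - h i xs)) (116 / 100 * \<theta> * K u)"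
proof (rule l2_le_mono)
  have "finite A" using assms(3) finite_subset by blast
  then show "l2_le M (\<lambda>\<omega>. \<gamma> *\<^sub>R (\<Sum>i\<in>A. h i (XV i u \<omega>) - h i xs)) (\<gamma> * (\<Sum>i\<in>A. 116 / 100 * L * K u))"
    using assms gradient_bound \<gamma> by (intro l2_le_scaleR l2_le_sum) auto
  have "\<gamma> * (\<Sum>i\<in>A. 116 / 100 * L * K u) = \<gamma> * (real (card A) * (116 / 100 * L * K u))" by simp
  also have "\<dots> \<le> \<gamma> * (real n * (116 / 100 * L * K u))"
    using assms(3) \<gamma> L_pos K_nonneg[of u] card_mono[of "{1..n}" A]
    by (intro mult_left_mono mult_right_mono) auto
  also have "\<dots> = 116 / 100 * (\<eta> * L) * K u" by (simp add: \<eta>_def)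
  also have "\<dots> \<le> 116 / 100 * \<theta> * K u"
    using \<eta>L_le K_nonneg[of u] by (intro mult_right_mono mult_left_mono) auto
  finally show "\<gamma> * (\<Sum>i\<in>A. 116 / 100 * L * K u) \<le> 116 / 100 * \<theta> * K u" .
qed

text \<open>Orthogonality gives \<open>sqrt n\<close> instead of \<open>n\<close> here, and
  \<open>\<gamma> * sqrt n * \<sigma> = \<eta> * S\<close>.\<close>

lemma noise_sum_bound:
  assumes "A \<subseteq> {1..n}"
  shows "l2_le M (\<lambda>\<omega>. \<gamma> *\<^sub>R (\<Sum>l\<in>A. noise l u \<omega>)) (\<eta> * S)"
proof (rule l2_le_mono)
  have "finite A" using assms finite_subset by blast
  have "l2_le M (\<lambda>\<omega>. 0 + (\<Sum>l\<in>A. noise l u \<omega>)) (sqrt (0\<^sup>2 + real (card A) * \<sigma>\<^sup>2))"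
    by (rule l2_le_add_noise[OF \<open>finite A\<close> assms _ l2_le_0]) simp
  then show "l2_le M (\<lambda>\<omega>. \<gamma> *\<^sub>R (\<Sum>l\<in>A. noise l u \<omega>)) (\<gamma> * sqrt (real (card A) * \<sigma>\<^sup>2))"
    using \<gamma> by (intro l2_le_scaleR) auto
  have "real (card A) \<le> real n" using card_mono[of "{1..n}" A] assms by simp
  then have "\<gamma> * sqrt (real (card A) * \<sigma>\<^sup>2) \<le> \<gamma> * sqrt (real n * \<sigma>\<^sup>2)"
    using \<gamma> by (intro mult_left_mono real_sqrt_le_mono mult_right_mono) auto
  also have "\<dots> = \<gamma> * (sqrt (real n) * \<sigma>)" using \<sigma> by (simp add: real_sqrt_mult)
  also have "\<dots> = \<eta> * S" using n by (simp add: \<eta>_def S_def field_simps)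
  finally show "\<gamma> * sqrt (real (card A) * \<sigma>\<^sup>2) \<le> \<eta> * S" .
qed

lemma initial_gradient_bound:
  assumes "A \<subseteq> {1..n}" and "A \<noteq> {} \<Longrightarrow> u \<le> d"
  shows "l2_le M (\<lambda>\<omega>. \<gamma> *\<^sub>R (\<Sum>l\<in>A. h l x0)) (101 / 100 * \<theta> * K u)"
proof (rule l2_le_const)
  show "norm (\<gamma> *\<^sub>R (\<Sum>l\<in>A. h l x0)) \<le> 101 / 100 * \<theta> * K u"
  proof (cases "A = {}")
    case True
    then show ?thesis using \<theta>_pos K_nonneg[of u] by simp
  next
    case False
    have "norm (\<gamma> *\<^sub>R (\<Sum>l\<in>A. h l x0)) \<le> \<gamma> * (\<Sum>l\<in>A. norm (h l x0))"
      using \<gamma> norm_sum[of "\<lambda>l. h l x0" A] by simp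
    also have "\<dots> \<le> \<eta> * L * b" by (rule sum_grad_le[OF assms(1)])
    also have "\<dots> \<le> \<theta> * (101 / 100 * K u)"
      using \<eta>L_le b_le_K[OF assms(2)[OF False]] b_nonneg \<theta>_pos by (intro mult_mono) auto
    finally show ?thesis by (simp add: mult_ac)
  qed
qed

lemma \<eta>S_le_K: "\<eta> * S \<le> \<theta> * K u"
  using \<eta>S_le mult_left_mono[OF sqrt_N_le_K[of u], of \<theta>] \<theta>_pos by linarith

text \<open>Nodes that have not started sit at \<open>x0\<close>, so their missing gradients are the constants \<open>h l x0\<close>;
  the gradients at the minimizer \<open>xs\<close> can be subtracted because they sum to \<open>0\<close>.\<close>

lemma sum_HV: "(\<Sum>l\<in>{1..n}. HV l u \<omega>)
    = (\<Sum>l\<in>{1..n}. h l (XV l u \<omega>)) - (\<Sum>l | l \<in> {1..n} \<and> u < depth B l. h l x0)"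
proof -
  have "(\<Sum>l\<in>{1..n}. HV l u \<omega>) = (\<Sum>l\<in>{1..n}. h l (XV l u \<omega>) - (if u < depth B l then h l x0 else 0))"
    by (intro sum.cong) (auto simp: HV_def XV_def X_0)
  then show ?thesis by (simp add: sum_subtractf sum.inter_filter[symmetric])
qed

lemma sum_GV: "(\<Sum>l\<in>{1..n}. GV l u \<omega>) = (\<Sum>l\<in>{1..n}. h l (XV l u \<omega>) - h l xs)
    - (\<Sum>l | l \<in> {1..n} \<and> u < depth B l. h l x0) + (\<Sum>l\<in>{1..n}. noise l u \<omega>)"
  using sum_HV[of u \<omega>] opt by (simp add: GV_eq sum.distrib sum_subtractf)

text \<open>In units of \<open>\<theta> * K u\<close>: 116/100 for the gradients, 101/100 for those
  missing at the start, 1 for the noise.\<close>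

lemma root_step_bound:
  assumes "root_bound u" "node_bound u"
  shows "l2_le M (\<lambda>\<omega>. z (Suc u) \<omega> - z u \<omega>) (4 * \<theta> * K u)"
proof -
  let ?A = "{l. l \<in> {1..n} \<and> u < depth B l}"
  let ?g = "\<lambda>\<omega>. \<gamma> *\<^sub>R (\<Sum>i\<in>{1..n}. h i (XV i u \<omega>) - h i xs)"
  let ?i = "\<gamma> *\<^sub>R (\<Sum>l\<in>?A. h l x0)" and ?e = "\<lambda>\<omega>. \<gamma> *\<^sub>R (\<Sum>l\<in>{1..n}. noise l u \<omega>)"
  have "u \<le> d" if "?A \<noteq> {}" using that depth_le_d by fastforce
  then have i: "l2_le M (\<lambda>\<omega>. ?i) (101 / 100 * \<theta> * K u)" by (intro initial_gradient_bound) auto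
  have "l2_le M (\<lambda>\<omega>. ?i - ?g \<omega> - ?e \<omega>) (101 / 100 * \<theta> * K u + 116 / 100 * \<theta> * K u + \<eta> * S)"
    using assms by (intro l2_le_diff i gradient_sum_bound noise_sum_bound) auto
  moreover have "?i - ?g \<omega> - ?e \<omega> = z (Suc u) \<omega> - z u \<omega>" for \<omega>
    unfolding z_Suc sum_GV by (simp only: scaleR_add_right scaleR_diff_right) simp
  ultimately have "l2_le M (\<lambda>\<omega>. z (Suc u) \<omega> - z u \<omega>) (101 / 100 * \<theta> * K u + 116 / 100 * \<theta> * K u + \<eta> * S)"
    by simp
  then show ?thesis
    using \<eta>S_le_K[of u] mult_nonneg_nonneg[OF less_imp_le[OF \<theta>_pos] K_nonneg[of u]]
    by (elim l2_le_mono) linarith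
qed

text \<open>The gradients at the two times are estimated separately. Agents of depth
  \<open>Suc v\<close> start just then and contribute their gradient at \<open>x0\<close>. In units
  of \<open>\<theta> * K v\<close> the total is at most 2 * 116/100 + 101/100 + 2 = 533/100.\<close>

lemma inner_tracker_bound:
  assumes "root_bound v" "node_bound v" "root_bound (Suc v)" "node_bound (Suc v)" and "A \<subseteq> {1..n}"
  shows "l2_le M (\<lambda>\<omega>. \<gamma> *\<^sub>R (\<Sum>l\<in>A. GV l (Suc v) \<omega> - GV l v \<omega>)) (6 * \<theta> * K v)"
proof -
  have "finite A" using assms(5) finite_subset by blast
  let ?C = "{l \<in> A. depth B l \<le> v}" and ?E = "{l \<in> A. depth B l = Suc v}"
  let ?g = "\<lambda>u \<omega>. \<gamma> *\<^sub>R (\<Sum>i\<in>?C. h i (XV i u \<omega>) - h i xs)"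
  let ?i = "\<gamma> *\<^sub>R (\<Sum>l\<in>?E. h l x0)" and ?e = "\<lambda>u \<omega>. \<gamma> *\<^sub>R (\<Sum>l\<in>A. noise l u \<omega>)"
  have "Suc v \<le> d" if "?E \<noteq> {}" using that depth_le_d assms(5) by fastforce
  then have i: "l2_le M (\<lambda>\<omega>. ?i) (101 / 100 * \<theta> * K (Suc v))"
    using assms(5) by (intro initial_gradient_bound) auto
  have C: "?C \<subseteq> {1..n}" using assms(5) by auto
  have "l2_le M (\<lambda>\<omega>. ?g (Suc v) \<omega> - ?g v \<omega> + ?i + (?e (Suc v) \<omega> - ?e v \<omega>))
    (116 / 100 * \<theta> * K (Suc v) + 116 / 100 * \<theta> * K v + 101 / 100 * \<theta> * K (Suc v) + (\<eta> * S + \<eta> * S))"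
    using assms C by (intro l2_le_add l2_le_diff i gradient_sum_bound noise_sum_bound) auto
  moreover have "?g (Suc v) \<omega> - ?g v \<omega> + ?i + (?e (Suc v) \<omega> - ?e v \<omega>)
      = \<gamma> *\<^sub>R (\<Sum>l\<in>A. GV l (Suc v) \<omega> - GV l v \<omega>)" for \<omega>
  proof -
    have "(\<Sum>l\<in>A. HV l (Suc v) \<omega> - HV l v \<omega>)
        = (\<Sum>l\<in>A. (if depth B l \<le> v then (h l (XV l (Suc v) \<omega>) - h l xs) - (h l (XV l v \<omega>) - h l xs) else 0)
            + (if depth B l = Suc v then h l x0 else 0))"
      by (intro sum.cong) (auto simp: HV_def XV_def X_0)
    also have "\<dots> = (\<Sum>i\<in>?C. h i (XV i (Suc v) \<omega>) - h i xs) - (\<Sum>i\<in>?C. h i (XV i v \<omega>) - h i xs)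
        + (\<Sum>l\<in>?E. h l x0)"
      unfolding sum.distrib sum.inter_filter[OF \<open>finite A\<close>, symmetric] by (simp only: sum_subtractf)
    finally have "(\<Sum>l\<in>A. GV l (Suc v) \<omega> - GV l v \<omega>) = (\<Sum>i\<in>?C. h i (XV i (Suc v) \<omega>) - h i xs)
        - (\<Sum>i\<in>?C. h i (XV i v \<omega>) - h i xs) + (\<Sum>l\<in>?E. h l x0)
        + ((\<Sum>l\<in>A. noise l (Suc v) \<omega>) - (\<Sum>l\<in>A. noise l v \<omega>))"
      by (simp add: GV_eq sum.distrib sum_subtractf algebra_simps)
    then show ?thesis by (simp only: scaleR_add_right scaleR_diff_right)
  qed
  ultimately have l2: "l2_le M (\<lambda>\<omega>. \<gamma> *\<^sub>R (\<Sum>l\<in>A. GV l (Suc v) \<omega> - GV l v \<omega>))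
    (116 / 100 * \<theta> * K (Suc v) + 116 / 100 * \<theta> * K v + 101 / 100 * \<theta> * K (Suc v) + (\<eta> * S + \<eta> * S))"
    by simp
  have "\<theta> * K (Suc v) \<le> \<theta> * K v" using \<theta>_pos K_decreasing[of v "Suc v"] by simp
  moreover have "0 \<le> \<theta> * K v" using \<theta>_pos K_nonneg by simp
  ultimately show ?thesis using \<eta>S_le_K[of v] by (intro l2_le_mono[OF l2]) linarith
qed

text \<open>Induction along the path to the root: a started node is compared with its parent two
  virtual steps earlier, and \<open>z\<close> with its own value then. Everything consulted lies
  strictly before \<open>\<tau>\<close>.\<close>

lemma node_bound_step:
  assumes IH: "\<And>u. u < \<tau> \<Longrightarrow> root_bound u \<and> node_bound u"
  shows "node_bound \<tau>"
  unfolding node_bound_def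
proof
  fix i assume i: "i \<in> {1..n}"
  let ?k = "depth B i"
  have step: "l2_le M (\<lambda>\<omega>. z (Suc u) \<omega> - z u \<omega>) (4 * \<theta> * K u)" if "u < \<tau>" for u
    using root_step_bound IH[OF that] by blast
  consider "i = 1" | "i \<noteq> 1" "\<tau> \<le> ?k" | "i \<noteq> 1" "?k < \<tau>" by linarith
  then show "l2_le M (\<lambda>\<omega>. XV i \<tau> \<omega> - z \<tau> \<omega>) (15 * \<theta> * real ?k * (K \<tau> / r ^ (2 * ?k)))"
  proof cases
    case 1
    then show ?thesis using l2_le_0 by (simp add: XV_def)
  next
    case 2
    \<comment> \<open>The node still sits at \<open>x0\<close>, which is also the root's initial
      value, so the deviation is the root's whole path; its length \<open>\<tau>\<close> is at most
      the depth.\<close>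
    have eq: "XV i \<tau> \<omega> - z \<tau> \<omega> = - (\<Sum>u<\<tau>. z (Suc u) \<omega> - z u \<omega>)" for \<omega>
      using 2 sum_lessThan_telescope[of "\<lambda>u. z u \<omega>" \<tau>] by (simp add: XV_def X_0)
    have "l2_le M (\<lambda>\<omega>. XV i \<tau> \<omega> - z \<tau> \<omega>) (\<Sum>u<\<tau>. 4 * \<theta> * K u)"
      unfolding eq using step by (intro l2_le_minus l2_le_sum) auto
    moreover have "(\<Sum>u<\<tau>. 4 * \<theta> * K u) \<le> (\<Sum>u<\<tau>. 4 * \<theta> * (K \<tau> / r ^ (2 * ?k)))"
      using 2 \<theta>_pos by (intro sum_mono mult_left_mono K_le_divide) auto
    moreover have "\<dots> \<le> 15 * \<theta> * real ?k * (K \<tau> / r ^ (2 * ?k))"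
    proof -
      have "4 * \<theta> * real \<tau> \<le> 15 * \<theta> * real ?k" using 2 \<theta>_pos by (intro mult_mono) auto
      then have "4 * \<theta> * real \<tau> * (K \<tau> / r ^ (2 * ?k)) \<le> 15 * \<theta> * real ?k * (K \<tau> / r ^ (2 * ?k))"
        using K_nonneg[of \<tau>] r_bounds by (intro mult_right_mono) auto
      then show ?thesis by (simp add: mult_ac)
    qed
    ultimately show ?thesis by (blast intro: l2_le_mono order_trans)
  next
    case 3
    let ?p = "parent B i"
    have kp: "?k = Suc (depth B ?p)" using depth_parent_le[OF i] 3 by auto
    have p: "?p \<in> {1..n}" by (rule parent_in[OF i])
    define t where "t = \<tau> - Suc ?k"
    have \<tau>: "\<tau> = Suc (t + ?k)" using 3 by (simp add: t_def)
    have XV: "XV i \<tau> \<omega> = X ?p t \<omega> - \<gamma> *\<^sub>R Y ?p t \<omega>" for \<omega>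
      using X_Suc[OF i, of t \<omega>] by (simp add: XV_def \<tau>)
    show ?thesis
    proof (cases "?p = 1")
      case True
      then have k: "?k = 1" using kp by simp
      \<comment> \<open>Root and child of the root both copy the updated root, so in virtual time
        the child lags by exactly one root step.\<close>
      have "XV i \<tau> \<omega> = z (Suc t) \<omega>" for \<omega>
        using X_Suc[of 1 t \<omega>] n by (simp add: XV True)
      then have eq: "XV i \<tau> \<omega> - z \<tau> \<omega> = - (z (Suc (Suc t)) \<omega> - z (Suc t) \<omega>)" for \<omega>
        by (simp add: \<tau> k)
      have l2: "l2_le M (\<lambda>\<omega>. XV i \<tau> \<omega> - z \<tau> \<omega>) (4 * \<theta> * K (Suc t))"
        unfolding eq by (intro l2_le_minus step) (simp add: \<tau> k)
      have "4 * \<theta> * K (Suc t) \<le> 15 * \<theta> * (K \<tau> / r ^ 2)"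
        using K_le_divide[of "Suc t" \<tau> 2] \<theta>_pos K_nonneg[of "Suc t"] by (intro mult_mono) (auto simp: \<tau> k)
      then show ?thesis using l2_le_mono[OF l2] by (simp add: k)
    next
      case False
      then have p2: "?p \<in> {2..n}" using p by auto
      define v where "v = t + depth B ?p - 1"
      have "depth B ?p \<noteq> 0" using depth_eq_0[of ?p B] p False by simp
      then have v: "t + depth B ?p = Suc v" and \<tau>v: "\<tau> = Suc (Suc (Suc v))" and k2: "2 \<le> ?k"
        using kp by (auto simp: v_def \<tau>)
      have Xp: "X ?p t \<omega> = XV ?p (Suc v) \<omega>" for \<omega> by (simp add: XV_def v[symmetric])
      \<comment> \<open>Deviation of the parent at time \<open>\<tau> - 2\<close>, its tracker step,
        and the two root steps made since: the new costs 6 + 4 + 4 fit into 15. The oldest time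
        \<open>\<tau> - 3\<close> is covered by \<open>r ^ (2 * ?k)\<close> since
        \<open>2 \<le> ?k\<close>.\<close>
      have eq: "XV i \<tau> \<omega> - z \<tau> \<omega> = (XV ?p (Suc v) \<omega> - z (Suc v) \<omega>)
          - \<gamma> *\<^sub>R (\<Sum>l\<in>subtree B n ?p. GV l (Suc v) \<omega> - GV l v \<omega>)
          - (z (Suc (Suc v)) \<omega> - z (Suc v) \<omega>) - (z (Suc (Suc (Suc v))) \<omega> - z (Suc (Suc v)) \<omega>)" for \<omega>
        using Y_inner[OF p2, of t \<omega>] unfolding XV Xp v by (simp add: \<tau>v)
      let ?c = "15 * \<theta> * real (depth B ?p) * (K (Suc v) / r ^ (2 * depth B ?p))"
      have lt: "v < \<tau>" "Suc v < \<tau>" "Suc (Suc v) < \<tau>" using \<tau>v by auto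
      have "l2_le M (\<lambda>\<omega>. XV ?p (Suc v) \<omega> - z (Suc v) \<omega>) ?c"
        using IH[OF lt(2)] p unfolding node_bound_def by blast
      then have l2: "l2_le M (\<lambda>\<omega>. XV i \<tau> \<omega> - z \<tau> \<omega>)
          (?c + 6 * \<theta> * K v + 4 * \<theta> * K (Suc v) + 4 * \<theta> * K (Suc (Suc v)))"
        unfolding eq using IH lt by (intro l2_le_diff inner_tracker_bound step subtree_subset) auto
      define q c where "q = K \<tau> / r ^ (2 * ?k)" and "c = K (Suc v) / r ^ (2 * depth B ?p)"
      have Kq: "K u \<le> q" if "v \<le> u" "u \<le> \<tau>" for u
        using that k2 unfolding q_def by (intro K_le_divide) (auto simp: \<tau>v)
      have "c \<le> q"
      proof -
        have "K (Suc v) \<le> K \<tau> / r ^ 2" by (rule K_le_divide) (auto simp: \<tau>v)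
        then have "K (Suc v) / r ^ (2 * depth B ?p) \<le> K \<tau> / r ^ 2 / r ^ (2 * depth B ?p)"
          using r_bounds by (intro divide_right_mono) auto
        then show ?thesis by (simp add: c_def q_def kp power_add power2_eq_square mult_ac)
      qed
      then have "15 * \<theta> * real (depth B ?p) * c \<le> 15 * \<theta> * real (depth B ?p) * q" using \<theta>_pos by (intro mult_left_mono) auto
      moreover have "\<theta> * K v \<le> \<theta> * q" "\<theta> * K (Suc v) \<le> \<theta> * q" "\<theta> * K (Suc (Suc v)) \<le> \<theta> * q"
        using \<theta>_pos by (intro mult_left_mono Kq; simp add: \<tau>v)+
      moreover have "0 \<le> \<theta> * q" using \<theta>_pos K_nonneg[of \<tau>] r_bounds by (simp add: q_def)
      moreover have "15 * \<theta> * real ?k * q = 15 * \<theta> * real (depth B ?p) * q + 15 * (\<theta> * q)"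
        by (simp add: kp algebra_simps)
      ultimately have "15 * \<theta> * real (depth B ?p) * c + 6 * \<theta> * K v + 4 * \<theta> * K (Suc v) + 4 * \<theta> * K (Suc (Suc v))
          \<le> 15 * \<theta> * real ?k * q" by linarith
      then show ?thesis unfolding c_def q_def by (rule l2_le_mono[OF l2])
    qed
  qed
qed

text \<open>The large Young factor \<open>10 / (\<eta> * \<mu>)\<close> cancels against
  \<open>(\<eta> * L * b)\<^sup>2 \<le> \<eta> * \<mu> * b\<^sup>2 / (100 * d\<^sup>2)\<close>,
  leaving a cost independent of \<open>\<eta>\<close> that is paid for \<open>d\<close> steps
  only.\<close>

lemma missing_gradient_le:
  "(1 + 10 / (\<eta> * \<mu>)) * \<eta>\<^sup>2 * (norm ((1 / real n) *\<^sub>R (\<Sum>l | l \<in> {1..n} \<and> u < depth B l. h l x0)))\<^sup>2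
    \<le> (if u < d then b\<^sup>2 / (9 * real d) else 0)"
proof (cases "u < d")
  case False
  then have "{l. l \<in> {1..n} \<and> u < depth B l} = {}" using depth_le_d by fastforce
  then show ?thesis unfolding \<open>{l. l \<in> {1..n} \<and> u < depth B l} = {}\<close> using False by simp
next
  case True
  let ?A = "{l. l \<in> {1..n} \<and> u < depth B l}"
  define x where "x = \<eta> * \<mu>"
  have x: "0 < x" "x \<le> 1 / 100" using \<eta>_pos \<mu> \<eta>\<mu>_small by (auto simp: x_def)
  have "\<gamma> * norm (\<Sum>l\<in>?A. h l x0) \<le> \<gamma> * (\<Sum>l\<in>?A. norm (h l x0))"
    using \<gamma> by (intro mult_left_mono norm_sum) auto
  also have "\<dots> \<le> \<eta> * L * b" by (rule sum_grad_le) auto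
  finally have "\<gamma> * norm (\<Sum>l\<in>?A. h l x0) \<le> \<eta> * L * b" .
  moreover have "\<eta> * norm ((1 / real n) *\<^sub>R (\<Sum>l\<in>?A. h l x0)) = \<gamma> * norm (\<Sum>l\<in>?A. h l x0)"
    using n by (simp add: \<eta>_def)
  ultimately have "(\<eta> * norm ((1 / real n) *\<^sub>R (\<Sum>l\<in>?A. h l x0)))\<^sup>2 \<le> (\<eta> * L * b)\<^sup>2"
    using \<eta>_pos by (intro power_mono mult_nonneg_nonneg) simp_all
  also have "\<dots> = \<eta> * (\<eta> * L\<^sup>2) * b\<^sup>2" by (simp add: power_mult_distrib power2_eq_square)
  also have "\<dots> \<le> \<eta> * (\<mu> / (100 * (real d)\<^sup>2)) * b\<^sup>2"
    using \<eta>L2 \<eta>_pos by (intro mult_right_mono mult_left_mono) auto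
  finally have e: "\<eta>\<^sup>2 * (norm ((1 / real n) *\<^sub>R (\<Sum>l\<in>?A. h l x0)))\<^sup>2 \<le> x / (100 * (real d)\<^sup>2) * b\<^sup>2"
    by (simp only: power_mult_distrib x_def times_divide_eq_right)
  have "(1 + 10 / x) * (\<eta>\<^sup>2 * (norm ((1 / real n) *\<^sub>R (\<Sum>l\<in>?A. h l x0)))\<^sup>2)
      \<le> (1 + 10 / x) * (x / (100 * (real d)\<^sup>2) * b\<^sup>2)"
    using e x by (intro mult_left_mono) auto
  also have "\<dots> = (x + 10) * (b\<^sup>2 / (100 * (real d)\<^sup>2))"
  proof -
    have "(1 + 10 / x) * x = x + 10" using x by (simp add: distrib_right)
    then have "(1 + 10 / x) * x * y = (x + 10) * y" for y by simp
    from this[of "b\<^sup>2 / (100 * (real d)\<^sup>2)"] show ?thesis by (simp add: mult_ac)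
  qed
  also have "\<dots> \<le> (100 / 9) * (b\<^sup>2 / (100 * real d))"
    using x d by (intro mult_mono divide_left_mono) (auto simp: power2_eq_square)
  also have "\<dots> = b\<^sup>2 / (9 * real d)" by simp
  finally show ?thesis using True by (simp add: x_def mult.assoc)
qed

lemma W_Suc: "W (Suc t) = W t + (if t < d then b\<^sup>2 / (2 * real d) else 0)"
  using d by (auto simp: W_def min_def field_simps)

text \<open>The budget in units of \<open>\<eta> * \<mu>\<close>, with
  \<open>(K t)\<^sup>2 \<le> 8 * (R * W t) + 2 * N\<close>: on \<open>R * W t\<close> the
  perturbations cost 0.8192 and the decay to \<open>r\<^sup>2\<close> requires 1/8; on
  \<open>N\<close> they cost 0.2048 and the noise 1/100. Both stay below 13/10. The growth of
  \<open>W\<close> pays for the missing gradients.\<close>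

lemma recursion_inequality:
  assumes v: "v \<le> r ^ (2 * t) * W t + N" and e: "e \<le> (16 / 100 * \<mu> * K t)\<^sup>2"
  shows "(1 - 13 / 10 * (\<eta> * \<mu>)) * v + 4 * \<eta> / \<mu> * e + (if t < d then b\<^sup>2 / (9 * real d) else 0)
      + (\<eta> * S)\<^sup>2 \<le> r ^ (2 * Suc t) * W (Suc t) + N"
proof -
  define x where "x = \<eta> * \<mu>"
  have x: "0 < x" "x \<le> 1 / 100" using \<eta>_pos \<mu> \<eta>\<mu>_small by (auto simp: x_def)
  define R where "R = r ^ (2 * t)"
  have R: "0 < R" using r_bounds by (simp add: R_def)
  have RV: "(r ^ t * sqrt V)\<^sup>2 = R * V"
    using V_nonneg by (simp add: R_def power_mult_distrib power_mult[symmetric] mult.commute)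
  have "(K t)\<^sup>2 \<le> 2 * (R * V + N)"
    using sum_squares_bound[of "r ^ t * sqrt V" "sqrt N"] N_pos
    unfolding K_def power2_sum RV by simp
  moreover have "R * V \<le> 4 * (R * W t)" using V_le_W[of t] R by simp
  ultimately have K2: "(K t)\<^sup>2 \<le> 8 * (R * W t) + 2 * N" by argo
  have "4 * \<eta> / \<mu> * e \<le> 4 * \<eta> / \<mu> * (16 / 100 * \<mu> * K t)\<^sup>2"
    using e \<eta>_pos \<mu> by (intro mult_left_mono) auto
  also have "\<dots> = 1024 / 10000 * x * (K t)\<^sup>2"
    using \<mu> by (simp add: x_def power_mult_distrib) (simp add: power2_eq_square)
  also have "\<dots> \<le> 1024 / 10000 * x * (8 * (R * W t) + 2 * N)"
    using K2 x by (intro mult_left_mono) auto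
  finally have e': "4 * \<eta> / \<mu> * e \<le> 1024 / 10000 * x * (8 * (R * W t) + 2 * N)" .
  have v': "(1 - 13 / 10 * x) * v \<le> (1 - 13 / 10 * x) * (R * W t + N)"
    using v x by (intro mult_left_mono) (auto simp: R_def)
  have m: "(if t < d then b\<^sup>2 / (9 * real d) else 0) \<le> r\<^sup>2 * R * (if t < d then b\<^sup>2 / (2 * real d) else 0)"
  proof (cases "t < d")
    case True
    have "998 / 1000 \<le> r ^ (2 * Suc t)"
      using r_power_d(2) power_decreasing[of "2 * Suc t" "2 * d" r] True r_bounds by simp
    then have "2 / 9 * (b\<^sup>2 / (2 * real d)) \<le> r ^ (2 * Suc t) * (b\<^sup>2 / (2 * real d))"
      by (intro mult_right_mono) auto
    then show ?thesis using True by (simp add: R_def power_add[symmetric])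
  qed simp
  have "r\<^sup>2 = 1 - x / 8 + (x / 16)\<^sup>2" by (simp add: r_def x_def power2_eq_square algebra_simps)
  then have "1 - x / 8 \<le> r\<^sup>2" by simp
  then have "(1 - x / 8) * (R * W t) \<le> r\<^sup>2 * (R * W t)"
    using R W_nonneg[of t] by (intro mult_right_mono) auto
  then have w: "(1 - x / 8) * (R * W t) + (if t < d then b\<^sup>2 / (9 * real d) else 0)
      \<le> r\<^sup>2 * R * W (Suc t)"
    using m unfolding W_Suc distrib_left by (simp only: mult.assoc)
  have combine: "A + E + m + F \<le> Z + N"
    if "A \<le> (1 - 13 / 10 * x) * (p + N)" "E \<le> 1024 / 10000 * x * (8 * p + 2 * N)"
      "(1 - x / 8) * p + m \<le> Z" "F = x * N / 100" "0 \<le> p" for A E F Z p m :: real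
  proof -
    have eq: "(1 - 13 / 10 * x) * (p + N) = p + N - 13 / 10 * (x * p) - 13 / 10 * (x * N)"
      "1024 / 10000 * x * (8 * p + 2 * N) = 8192 / 10000 * (x * p) + 2048 / 10000 * (x * N)"
      "(1 - x / 8) * p = p - 1 / 8 * (x * p)"
      by (simp_all add: algebra_simps)
    have "0 \<le> x * p" "0 \<le> x * N" using x that(5) N_pos by auto
    then show ?thesis using that(1)[unfolded eq] that(2)[unfolded eq] that(3)[unfolded eq] that(4)
      by linarith
  qed
  have "(\<eta> * S)\<^sup>2 = x * N / 100" unfolding \<eta>S_sq by (simp add: x_def)
  moreover have "r\<^sup>2 * R = r ^ (2 * Suc t)" by (simp add: R_def power2_eq_square)
  ultimately show ?thesis
    using combine[OF v' e' w] R W_nonneg[of t] unfolding x_def by simp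
qed

text \<open>The noiseless step is estimated pointwise and integrated; the noise is added afterwards,
  orthogonally, so that it contributes only its variance.\<close>

lemma root_bound_Suc:
  assumes "root_bound t" "node_bound t"
  shows "root_bound (Suc t)"
proof -
  let ?q = "\<lambda>\<omega>. (1 / real n) *\<^sub>R (\<Sum>l\<in>{1..n}. h l (z t \<omega>))"
  let ?e1 = "\<lambda>\<omega>. (1 / real n) *\<^sub>R (\<Sum>l\<in>{1..n}. h l (XV l t \<omega>) - h l (z t \<omega>))"
  let ?e2 = "(1 / real n) *\<^sub>R (\<Sum>l | l \<in> {1..n} \<and> t < depth B l. h l x0)"
  \<comment> \<open>The next error without its noise, hence determined by the samples in
    \<open>past t\<close>.\<close>
  define U where "U = (\<lambda>\<omega>. z t \<omega> - xs - \<gamma> *\<^sub>R (\<Sum>l\<in>{1..n}. HV l t \<omega>))"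
  define m where "m = (if t < d then b\<^sup>2 / (9 * real d) else 0)"
  define c where "c = (1 - 13 / 10 * (\<eta> * \<mu>)) * (\<integral>\<omega>. (norm (z t \<omega> - xs))\<^sup>2 \<partial>M)
    + 4 * \<eta> / \<mu> * (\<integral>\<omega>. (norm (?e1 \<omega>))\<^sup>2 \<partial>M) + m"
  have U_eq: "U \<omega> = (z t \<omega> - xs) - \<eta> *\<^sub>R ?q \<omega> - \<eta> *\<^sub>R ?e1 \<omega> - \<eta> *\<^sub>R (- ?e2)" for \<omega>
  proof -
    have "\<eta> * (1 / real n) = \<gamma>" using n by (simp add: \<eta>_def)
    then have "\<eta> *\<^sub>R ((1 / real n) *\<^sub>R y) = \<gamma> *\<^sub>R y" for y :: 'a by simp
    then show ?thesis unfolding U_def sum_HV sum_subtractf scaleR_minus_right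
      by (simp only: scaleR_diff_right) simp
  qed
  have J: "U \<in> borel_measurable (sigma_of J)" if "J \<subseteq> {1..n} \<times> UNIV" "past t \<subseteq> J" for J
  proof -
    have XV: "XV l t \<in> borel_measurable (sigma_of J)" if "l \<in> {1..n}" for l
      using XV_measurable_sigma_of[OF \<open>J \<subseteq> _\<close> \<open>past t \<subseteq> J\<close> that] .
    have "z t \<in> borel_measurable (sigma_of J)" using XV[of 1] n by (simp add: XV_def[abs_def])
    moreover have "HV l t \<in> borel_measurable (sigma_of J)" if "l \<in> {1..n}" for l
      by (rule HV_measurable[OF that XV[OF that]])
    ultimately show ?thesis unfolding U_def
      by (intro borel_measurable_diff borel_measurable_scaleR borel_measurable_sum) auto
  qed
  have hz: "(\<lambda>\<omega>. h l (z t \<omega>)) \<in> borel_measurable M" if "l \<in> {1..n}" for l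
    by (rule measurable_compose[OF z_measurable h_measurable[OF that]])
  have e1: "l2_le M ?e1 (16 / 100 * \<mu> * K t)"
  proof -
    have "l2_le M (\<lambda>\<omega>. h l (XV l t \<omega>) - h l (z t \<omega>)) (L * (16 / 100 * (\<mu> / L) * K t))" if l: "l \<in> {1..n}" for l
      using node_bound_K[OF assms(2) l] h_XV_measurable[OF l] hz[OF l] h_lip[OF l] L_pos
      by (elim l2_le_norm_bound) auto
    then have "l2_le M ?e1 (1 / real n * (\<Sum>l\<in>{1..n}. L * (16 / 100 * (\<mu> / L) * K t)))"
      by (intro l2_le_scaleR l2_le_sum) auto
    then show ?thesis using n L_pos by simp
  qed
  note w = l2_leD[OF assms(1)[unfolded root_bound_def]]
  have m0: "0 \<le> m" by (simp add: m_def)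
  have pt: "(norm (U \<omega>))\<^sup>2 \<le> (1 - 13 / 10 * (\<eta> * \<mu>)) * (norm (z t \<omega> - xs))\<^sup>2
      + 4 * \<eta> / \<mu> * (norm (?e1 \<omega>))\<^sup>2 + m" for \<omega>
  proof -
    have "\<mu> * (norm (z t \<omega> - xs))\<^sup>2 \<le> (z t \<omega> - xs) \<bullet> ?q \<omega>"
      using mono[of "z t \<omega>" xs] opt by (simp add: inner_commute)
    moreover have "norm (?q \<omega>) \<le> L * norm (z t \<omega> - xs)"
    proof -
      have "norm (\<Sum>l\<in>{1..n}. h l (z t \<omega>)) = norm (\<Sum>l\<in>{1..n}. h l (z t \<omega>) - h l xs)"
        using opt by (simp add: sum_subtractf)
      also have "\<dots> \<le> (\<Sum>l\<in>{1..n}. L * norm (z t \<omega> - xs))"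
        using h_lip by (intro sum_norm_le) auto
      finally show ?thesis using n by (simp add: field_simps)
    qed
    moreover have "\<eta> * L\<^sup>2 \<le> \<mu> / 100"
    proof -
      have "\<eta> * L\<^sup>2 * 1 \<le> \<eta> * L\<^sup>2 * (real d)\<^sup>2" using d \<eta>_pos by (intro mult_left_mono) auto
      then show ?thesis using step' by simp
    qed
    ultimately have "(norm (U \<omega>))\<^sup>2 \<le> (1 - 13 / 10 * (\<eta> * \<mu>)) * (norm (z t \<omega> - xs))\<^sup>2
        + 4 * \<eta> / \<mu> * (norm (?e1 \<omega>))\<^sup>2 + (1 + 10 / (\<eta> * \<mu>)) * \<eta>\<^sup>2 * (norm (- ?e2))\<^sup>2"
      unfolding U_eq using \<mu> \<eta>_pos \<eta>\<mu>_small by (intro perturbed_gradient_step) auto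
    also have "(1 + 10 / (\<eta> * \<mu>)) * \<eta>\<^sup>2 * (norm (- ?e2))\<^sup>2 \<le> m"
      unfolding norm_minus_cancel m_def by (rule missing_gradient_le)
    finally show ?thesis by simp
  qed
  have UM: "U \<in> borel_measurable M" by (rule sigma_of_measurableD[OF past_subset J[OF past_subset order_refl]])
  have int_bd: "integrable M (\<lambda>\<omega>. (1 - 13 / 10 * (\<eta> * \<mu>)) * (norm (z t \<omega> - xs))\<^sup>2
      + 4 * \<eta> / \<mu> * (norm (?e1 \<omega>))\<^sup>2 + m)"
    using w(2) l2_leD(2)[OF e1] by (intro Bochner_Integration.integrable_add integrable_mult_right) auto
  have intU: "integrable M (\<lambda>\<omega>. (norm (U \<omega>))\<^sup>2)"
  proof (rule Bochner_Integration.integrable_bound[OF int_bd])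
    show "AE \<omega> in M. norm ((norm (U \<omega>))\<^sup>2) \<le> norm ((1 - 13 / 10 * (\<eta> * \<mu>)) * (norm (z t \<omega> - xs))\<^sup>2
      + 4 * \<eta> / \<mu> * (norm (?e1 \<omega>))\<^sup>2 + m)"
      by (rule AE_I2) (use pt in \<open>simp only: real_norm_def abs_power2 abs_ge_self order_trans[OF pt]\<close>)
  qed (use UM in simp)
  have EU: "(\<integral>\<omega>. (norm (U \<omega>))\<^sup>2 \<partial>M) \<le> c"
  proof -
    have "(\<integral>\<omega>. (norm (U \<omega>))\<^sup>2 \<partial>M) \<le> (\<integral>\<omega>. (1 - 13 / 10 * (\<eta> * \<mu>)) * (norm (z t \<omega> - xs))\<^sup>2
        + 4 * \<eta> / \<mu> * (norm (?e1 \<omega>))\<^sup>2 + m \<partial>M)"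
      by (rule integral_mono[OF intU int_bd pt])
    also have "\<dots> = c"
      using w(2) l2_leD(2)[OF e1] by (simp add: c_def prob_space)
    finally show ?thesis .
  qed
  have c0: "0 \<le> c" by (rule order_trans[OF _ EU]) simp
  then have l2U: "l2_le M U (sqrt c)" using EU UM intU by (simp add: l2_le_def)
  \<comment> \<open>Dividing by \<open>- \<gamma>\<close> brings the step into the form of an
    adapted vector plus unscaled noises; multiplying back by \<open>\<gamma>\<close> gives the new
    error up to its sign.\<close>
  have "l2_le M (\<lambda>\<omega>. (- (1 / \<gamma>)) *\<^sub>R U \<omega>) (1 / \<gamma> * sqrt c)"
    using UM \<gamma> by (intro l2_le_norm_bound[OF l2U]) auto
  then have "l2_le M (\<lambda>\<omega>. (- (1 / \<gamma>)) *\<^sub>R U \<omega> + (\<Sum>l\<in>{1..n}. noise l t \<omega>))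
      (sqrt ((1 / \<gamma> * sqrt c)\<^sup>2 + real (card {1..n}) * \<sigma>\<^sup>2))"
    using J by (intro l2_le_add_noise) auto
  from l2_le_scaleR[OF this, of \<gamma>]
  have "l2_le M (\<lambda>\<omega>. \<gamma> *\<^sub>R ((- (1 / \<gamma>)) *\<^sub>R U \<omega> + (\<Sum>l\<in>{1..n}. noise l t \<omega>)))
      (\<gamma> * sqrt ((1 / \<gamma> * sqrt c)\<^sup>2 + real (card {1..n}) * \<sigma>\<^sup>2))"
    using \<gamma> by simp
  moreover have "\<gamma> *\<^sub>R ((- (1 / \<gamma>)) *\<^sub>R U \<omega> + (\<Sum>l\<in>{1..n}. noise l t \<omega>)) = - (z (Suc t) \<omega> - xs)" for \<omega>
  proof -
    have "\<gamma> *\<^sub>R ((- (1 / \<gamma>)) *\<^sub>R U \<omega> + s) = \<gamma> *\<^sub>R s - U \<omega>" for s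
      using \<gamma> by (simp add: scaleR_add_right scaleR_diff_right)
    then show ?thesis unfolding z_Suc U_def GV_eq sum.distrib by (simp add: scaleR_add_right)
  qed
  moreover have "\<gamma> * sqrt ((1 / \<gamma> * sqrt c)\<^sup>2 + real (card {1..n}) * \<sigma>\<^sup>2) = sqrt (c + (\<eta> * S)\<^sup>2)"
  proof -
    have "\<gamma> * sqrt ((1 / \<gamma> * sqrt c)\<^sup>2 + real (card {1..n}) * \<sigma>\<^sup>2)
        = sqrt (\<gamma>\<^sup>2 * ((1 / \<gamma> * sqrt c)\<^sup>2 + real n * \<sigma>\<^sup>2))"
      using \<gamma> by (simp add: real_sqrt_mult)
    also have "\<gamma>\<^sup>2 * ((1 / \<gamma> * sqrt c)\<^sup>2 + real n * \<sigma>\<^sup>2) = c + \<gamma>\<^sup>2 * (real n * \<sigma>\<^sup>2)"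
      using \<gamma> c0 by (simp add: power_mult_distrib power_divide distrib_left)
    also have "\<gamma>\<^sup>2 * (real n * \<sigma>\<^sup>2) = (\<eta> * S)\<^sup>2"
      using n by (simp add: \<eta>_def S_def power_mult_distrib power_divide) (simp add: power2_eq_square)
    finally show ?thesis .
  qed
  ultimately have "l2_le M (\<lambda>\<omega>. - (z (Suc t) \<omega> - xs)) (sqrt (c + (\<eta> * S)\<^sup>2))" by simp
  from l2_le_minus[OF this] have "l2_le M (\<lambda>\<omega>. z (Suc t) \<omega> - xs) (sqrt (c + (\<eta> * S)\<^sup>2))" by simp
  moreover have "c + (\<eta> * S)\<^sup>2 \<le> r ^ (2 * Suc t) * W (Suc t) + N"
  proof -
    have "0 \<le> r ^ (2 * t) * W t + N" using r_bounds W_nonneg N_pos by simp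
    then show ?thesis
      using w(4) l2_leD(4)[OF e1] unfolding c_def m_def by (intro recursion_inequality) auto
  qed
  ultimately show ?thesis unfolding root_bound_def by (elim l2_le_mono) simp
qed

lemma root_bound_0: "root_bound 0"
proof -
  have "a \<le> sqrt (W 0 + N)"
    using N_pos by (intro real_le_rsqrt) (simp add: W_def)
  then show ?thesis unfolding root_bound_def X_0 by (intro l2_le_const) (simp add: a_def)
qed

text \<open>The root bound at \<open>t\<close> needs both bounds at \<open>t - 1\<close>, the node
  bound at \<open>t\<close> needs both bounds at all smaller times, so one strong induction serves
  both.\<close>

lemma bounds: "root_bound t \<and> node_bound t"
proof (induction t rule: less_induct)
  case (less t)
  have "root_bound t"
  proof (cases t)
    case 0
    then show ?thesis using root_bound_0 by simp
  next
    case (Suc u)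
    then show ?thesis using less[of u] root_bound_Suc by simp
  qed
  then show ?case using node_bound_step less by blast
qed

lemma root_second_moment:
  "integrable M (\<lambda>\<omega>. (norm (z t \<omega> - xs))\<^sup>2)"
  "(\<integral>\<omega>. (norm (z t \<omega> - xs))\<^sup>2 \<partial>M) \<le> exp (- (\<eta> * \<mu> * real t / 8)) * V + N"
proof -
  note l2 = l2_leD[OF conjunct1[OF bounds[of t], unfolded root_bound_def]]
  show "integrable M (\<lambda>\<omega>. (norm (z t \<omega> - xs))\<^sup>2)" by (rule l2(2))
  have "r ^ (2 * t) \<le> exp (- (\<eta> * \<mu> / 16)) ^ (2 * t)"
    using r_bounds exp_ge_add_one_self[of "- (\<eta> * \<mu> / 16)"] by (intro power_mono) (auto simp: r_def)
  also have "\<dots> = exp (- (\<eta> * \<mu> * real t / 8))" by (simp add: exp_of_nat_mult[symmetric])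
  finally have "r ^ (2 * t) * W t \<le> exp (- (\<eta> * \<mu> * real t / 8)) * V"
    using W_le_V[of t] W_nonneg[of t] by (intro mult_mono) auto
  moreover have "0 \<le> r ^ (2 * t) * W t + N" using r_bounds W_nonneg N_pos by simp
  ultimately show "(\<integral>\<omega>. (norm (z t \<omega> - xs))\<^sup>2 \<partial>M) \<le> exp (- (\<eta> * \<mu> * real t / 8)) * V + N"
    using l2(4) by simp
qed

end

section \<open>From the abstract iteration to BTPP with the prescribed step size\<close>

lemma frobenius_norm_sq: "(frobenius_norm n A)\<^sup>2 = (\<Sum>i\<in>{1..n}. (norm (A i))\<^sup>2)"
  by (simp add: frobenius_norm_def norm_vec_def L2_set_def sum_nonneg)

theorem theorem2p4:
  fixes B n d T :: nat
    and f :: "nat \<Rightarrow> real ^ 'p \<Rightarrow> real"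
    and g :: "nat \<Rightarrow> real ^ 'p \<Rightarrow> 's \<Rightarrow> real ^ 'p"
    and D :: "nat \<Rightarrow> 's measure"
    and M :: "'w measure"
    and \<xi> :: "nat \<Rightarrow> nat \<Rightarrow> 'w \<Rightarrow> 's"
    and x0 xstar :: "real ^ 'p"
    and \<sigma> L \<mu> \<kappa> \<gamma> :: real
  assumes "B \<ge> 2" and "n \<ge> 2"
    and "(real B ^ d - 1) / (real B - 1) < real n"
    and "real n \<le> (real B ^ (d + 1) - 1) / (real B - 1)"
    and "\<sigma> > 0" and "L > 0" and "\<mu> > 0"
    \<comment> \<open>independent samples, that of agent i having law D i\<close>
    and "prob_space M"
    and "prob_space.indep_vars M (\<lambda>(i, t). D i) (\<lambda>(i, t). \<xi> i t) ({1..n} \<times> UNIV)"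
    and "\<And>i t. i \<in> {1..n} \<Longrightarrow> distr M (D i) (\<xi> i t) = D i"
    \<comment> \<open>stochastic gradients: measurable, unbiased, of variance at most \<sigma>^2\<close>
    and "\<And>i. i \<in> {1..n} \<Longrightarrow> (\<lambda>(x, s). g i x s) \<in> borel_measurable (borel \<Otimes>\<^sub>M D i)"
    and "\<And>i x. i \<in> {1..n} \<Longrightarrow> has_bochner_integral (D i) (g i x) (gradient (f i) x)"
    and "\<And>i x. i \<in> {1..n} \<Longrightarrow>
           integrable (D i) (\<lambda>s. (norm (g i x s - gradient (f i) x))\<^sup>2)"
    and "\<And>i x. i \<in> {1..n} \<Longrightarrow>
           (\<integral>s. (norm (g i x s - gradient (f i) x))\<^sup>2 \<partial>D i) \<le> \<sigma>\<^sup>2"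
    \<comment> \<open>objective functions\<close>
    and "\<And>i x. i \<in> {1..n} \<Longrightarrow> f i differentiable (at x)"
    and "\<And>i. i \<in> {1..n} \<Longrightarrow> bdd_below (range (f i))"
    and "\<And>i. i \<in> {1..n} \<Longrightarrow> L-lipschitz_on UNIV (gradient (f i))"
    and "strongly_convex \<mu> (average_objective n f)"
    and "xstar = (ARG_MIN (average_objective n f) x. True)"
    and "\<kappa> = L / \<mu>"
    and "T \<ge> 2 * d"
    and "\<gamma> = min (1 / (100 * real n * (real d)\<^sup>2 * \<kappa> * L))
                 (16 * ln (real n * (real T + 1)\<^sup>2) / (real n * (real T + 1) * \<mu>))"
  shows "integrable M (\<lambda>\<omega>. (norm (btpp_X B n \<gamma> g x0 (\<lambda>i t. \<xi> i t \<omega>) T 1 - xstar))\<^sup>2) \<and>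
    prob_space.expectation M
      (\<lambda>\<omega>. (norm (btpp_X B n \<gamma> g x0 (\<lambda>i t. \<xi> i t \<omega>) T 1 - xstar))\<^sup>2)
    \<le> 2240 * \<sigma>\<^sup>2 * ln (real n * (real T + 1)\<^sup>2) / (real n * (real T + 1) * \<mu>\<^sup>2)
      + 26880000 * real d ^ 6 * \<kappa>\<^sup>2 * \<sigma>\<^sup>2 * (ln (real n * (real T + 1)\<^sup>2))\<^sup>2
          / (real n * (real T + 1)\<^sup>2 * \<mu>\<^sup>2)
      + max (exp (- (real T / (800 * (real d)\<^sup>2 * \<kappa>\<^sup>2))))
            (40 / (real n * (real T + 1)\<^sup>2))
        * ((norm (x0 - xstar))\<^sup>2
           + 1 / (real n * L\<^sup>2) * (frobenius_norm n (stacked_gradient f (\<lambda>_. x0)))\<^sup>2)"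
proof -
  note B = assms(1) and n = assms(2) and size = assms(4) and \<sigma> = assms(5) and L = assms(6) and \<mu> = assms(7)
    and diff = assms(15) and lip = assms(17) and sc = assms(18) and xstar = assms(19) and \<kappa> = assms(20)
    and T = assms(21) and \<gamma> = assms(22)
  let ?h = "\<lambda>i. gradient (f i)" and ?F = "average_objective n f"
  have gF: "gradient ?F x = (1 / real n) *\<^sub>R (\<Sum>i\<in>{1..n}. ?h i x)" for x
    by (rule gradient_eqI[OF gderiv_average_objective[OF diff]])
  \<comment> \<open>For \<open>d = 0\<close> the upper bound on the size would leave a single
    node.\<close>
  have d: "1 \<le> d"
  proof (rule ccontr)
    assume "\<not> 1 \<le> d"
    then have "d = 0" by simp
    then show False using size B n by simp
  qed
  have dF: "?F differentiable (at x)" for x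
    using gderiv_average_objective[where n = n and f = f and x = x, OF diff] by (auto simp: gderiv_def differentiable_def)
  have lipF: "L-lipschitz_on UNIV (gradient ?F)"
  proof (rule lipschitz_onI)
    fix x y :: "real ^ 'p"
    have "dist (gradient ?F x) (gradient ?F y) = 1 / real n * norm (\<Sum>i\<in>{1..n}. ?h i x - ?h i y)"
      by (simp add: dist_norm gF sum_subtractf scaleR_diff_right[symmetric])
    also have "\<dots> \<le> 1 / real n * (\<Sum>i\<in>{1..n}. L * dist x y)"
      using lipschitz_onD[OF lip] by (intro mult_left_mono sum_norm_le) (auto simp: dist_norm)
    also have "\<dots> = L * dist x y" using n by simp
    finally show "dist (gradient ?F x) (gradient ?F y) \<le> L * dist x y" .
  qed (use L in simp)
  have \<mu>L: "\<mu> \<le> L" by (rule strongly_convex_le_Lipschitz[OF sc lipF])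
  define Q where "Q = real n * (real T + 1)\<^sup>2"
  have Q: "1 < Q"
  proof -
    have "1 * 1 < real n * (real T + 1)\<^sup>2" using n by (intro mult_less_le_imp_less) auto
    then show ?thesis by (simp add: Q_def)
  qed
  define \<gamma>1 \<gamma>2 where "\<gamma>1 = 1 / (100 * real n * (real d)\<^sup>2 * \<kappa> * L)"
    and "\<gamma>2 = 16 * ln Q / (real n * (real T + 1) * \<mu>)"
  have \<gamma>_min: "\<gamma> = min \<gamma>1 \<gamma>2" using \<gamma> by (simp add: \<gamma>1_def \<gamma>2_def Q_def)
  have \<kappa>_pos: "0 < \<kappa>" using \<kappa> L \<mu> by simp
  have \<gamma>_pos: "0 < \<gamma>"
    using n d L \<mu> \<kappa>_pos Q by (auto simp: \<gamma>_min \<gamma>1_def \<gamma>2_def intro!: divide_pos_pos mult_pos_pos)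
  have opt: "(\<Sum>i\<in>{1..n}. ?h i xstar) = 0"
    using gradient_arg_min_strongly_convex[OF sc \<mu> dF] n unfolding xstar[symmetric] gF by simp
  interpret prob_space M by (rule assms(8))
  interpret stochastic_push_pull M B n d ?h g D \<xi> x0 xstar \<sigma> L \<mu> \<gamma>
  proof unfold_locales
    show "\<mu> * (norm (x - y))\<^sup>2
      \<le> ((1 / real n) *\<^sub>R (\<Sum>i\<in>{1..n}. ?h i x) - (1 / real n) *\<^sub>R (\<Sum>i\<in>{1..n}. ?h i y)) \<bullet> (x - y)" for x y
      using strongly_convex_gradient_monotone[OF sc] unfolding gF .
    have "real n * \<gamma> \<le> real n * \<gamma>1" unfolding \<gamma>_min by (intro mult_left_mono) auto
    also have "\<dots> = \<mu> / (100 * (real d)\<^sup>2 * L\<^sup>2)"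
      using n L \<mu> by (simp add: \<gamma>1_def \<kappa> power2_eq_square)
    finally show "real n * \<gamma> \<le> \<mu> / (100 * (real d)\<^sup>2 * L\<^sup>2)" .
  qed (use assms(9-14) B n d \<sigma> \<mu> \<mu>L \<gamma>_pos lip opt depth_le_of_size[OF B size] in auto)
  have V: "V = (norm (x0 - xstar))\<^sup>2
      + 1 / (real n * L\<^sup>2) * (frobenius_norm n (stacked_gradient f (\<lambda>_. x0)))\<^sup>2"
    by (simp add: V_def a_def b_sq frobenius_norm_sq stacked_gradient_def)
  have N: "N \<le> 2240 * \<sigma>\<^sup>2 * ln Q / (real n * (real T + 1) * \<mu>\<^sup>2)"
  proof -
    \<comment> \<open>The noise floor is linear in the step size, so the second entry of the minimum
      gives the constant 100 * 16 = 1600.\<close>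
    have "N = 100 * \<sigma>\<^sup>2 / \<mu> * \<gamma>"
      using n by (simp add: N_def S_def \<eta>_def power_divide)
    also have "\<dots> \<le> 100 * \<sigma>\<^sup>2 / \<mu> * \<gamma>2" using \<mu> by (intro mult_left_mono) (auto simp: \<gamma>_min)
    also have "\<dots> = 1600 * (\<sigma>\<^sup>2 * ln Q / (real n * (real T + 1) * \<mu>\<^sup>2))"
      by (simp add: \<gamma>2_def power2_eq_square mult_ac)
    also have "\<dots> \<le> 2240 * (\<sigma>\<^sup>2 * ln Q / (real n * (real T + 1) * \<mu>\<^sup>2))"
      using Q by (intro mult_right_mono) auto
    finally show ?thesis by simp
  qed
  have E: "exp (- (\<eta> * \<mu> * real T / 8)) \<le> max (exp (- (real T / (800 * (real d)\<^sup>2 * \<kappa>\<^sup>2)))) (40 / Q)"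
  proof (cases "\<gamma>1 \<le> \<gamma>2")
    case True
    then have "\<gamma> = \<gamma>1" using \<gamma>_min by simp
    then have eq: "\<eta> = real n * \<gamma>1" using \<eta>_def by simp
    have "\<eta> * \<mu> * real T / 8 = real T / (800 * (real d)\<^sup>2 * \<kappa>\<^sup>2)"
      unfolding eq \<gamma>1_def \<kappa> using n L \<mu> d by (simp add: power2_eq_square mult_ac)
    then show ?thesis by (simp only: max.cobounded1)
  next
    case False
    then have "\<gamma> = \<gamma>2" using \<gamma>_min by simp
    then have eq: "\<eta> = real n * \<gamma>2" using \<eta>_def by simp
    \<comment> \<open>With the logarithmic step size the exponent is
      \<open>2 * ln Q * (T / (T + 1))\<close>; it reaches \<open>ln Q\<close>, and hence the decay
      \<open>1 / Q\<close>, as soon as \<open>T\<close> is at least 1.\<close>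
    have "real T / (real T + 1) \<ge> 1 / 2" using T d by (simp add: field_simps)
    then have "2 * ln Q * (1 / 2) \<le> 2 * ln Q * (real T / (real T + 1))"
      using Q by (intro mult_left_mono) auto
    also have "\<dots> = \<eta> * \<mu> * real T / 8"
    proof -
      have "k * (16 * l / (k * y * m)) * m * t / 8 = 2 * l * (t / y)" if "0 < k" "0 < m" for k l m t y :: real
        using that by simp
      from this[of "real n" \<mu> "ln Q" "real T + 1" "real T"] show ?thesis unfolding eq \<gamma>2_def using n \<mu> by (simp only: of_nat_0_less_iff)
    qed
    finally have "exp (- (\<eta> * \<mu> * real T / 8)) \<le> exp (- ln Q)" by simp
    also have "\<dots> = 1 / Q" using Q by (simp add: exp_minus inverse_eq_divide)
    also have "\<dots> \<le> 40 / Q" using Q by (intro divide_right_mono) auto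
    finally show ?thesis by simp
  qed
  have "exp (- (\<eta> * \<mu> * real T / 8)) * V
      \<le> max (exp (- (real T / (800 * (real d)\<^sup>2 * \<kappa>\<^sup>2)))) (40 / Q) * V"
    using E V_nonneg by (rule mult_right_mono)
  moreover have "0 \<le> 26880000 * real d ^ 6 * \<kappa>\<^sup>2 * \<sigma>\<^sup>2 * (ln Q)\<^sup>2 / (real n * (real T + 1)\<^sup>2 * \<mu>\<^sup>2)"
    by simp
  ultimately show ?thesis
    using root_second_moment[of T] N unfolding X_def V Q_def by (intro conjI) linarith+
qed

end
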